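(* Let $k$ be an algebraically closed field and let $A$ be an algebroid curve over $k$. Let $f:A\to B$ and $g:A\to C$ be two $k$-algebra homomorphisms, and let $J$ and $J'$ be proper regular ideals of $B$ and $C$ respectively, such that $f(A)+J$ and $g(A)+J'$ are algebroid curves over $k$, $J$ and $J'$ are finitely generated $A$-modules, $f^{-1}(J)=g^{-1}(J')$, $J\subseteq\mathrm{Jac}(B)$ and $J'\subseteq\mathrm{Jac}(C)$. Then $A\bowtie^{f,g}(J,J')$ is also an algebroid curve over $k$, with $h_{f(A)+J}+h_{g(A)+J'}$ branches. Furthermore, there is a bijective correspondence between the branches of $A\bowtie^{f,g}(J,J')$ and those of $f(A)+J$ and $g(A)+J'$ (taken together), in which corresponding branches are isomorphic.
   Context: All rings are commutative with identity. The bi-amalgamation is the subring $A\bowtie^{f,g}(J,J')=\{(f(a)+j,\,g(a)+j') : a\in A,\ (j,j')\in J\times J'\}$ of $B\times C$; $f(A)+J$ and $g(A)+J'$ are subrings of $B$ and $C$. $J$ and $J'$ are $A$-modules via $f$ and $g$. $\mathrm{Jac}$ denotes the Jacobson radical. A regular ideal is an ideal containing a nonzerodivisor. An algebroid curve over an algebraically closed field $k$ is a one-dimensional, reduced, complete (Noetherian) local $k$-algebra with residue field $k$; equivalently, a one-dimensional reduced local ring of the form $R=k[[x_1,\ldots,x_n]]/(I_1\cap\cdots\cap I_h)$ where $I_1,\dots,I_h$ are (distinct) prime ideals of $k[[x_1,\ldots,x_n]]$ of height $n-1$. The ring $R_i=k[[x_1,\ldots,x_n]]/I_i$ is the $i$-th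 (algebroid) branch of $R$ (so the branches are the quotients of $R$ by its minimal primes), and $h=h_R$ is the number of branches of $R$. *)

theory Defs
  imports "HOL-Algebra.Algebra" "HOL-Library.Extended_Nat"
begin

text \<open>
  A \<open>k\<close>-algebra is a record of type \<open>('k, 'a) module\<close> satisfying the library locale \<^locale>\<open>algebra\<close>
  (which makes both the base and the algebra commutative rings).
\<close>

section \<open>Commutative algebra\<close>

definition reduced_ring :: "('a, 'z) ring_scheme \<Rightarrow> bool" where
  "reduced_ring R \<longleftrightarrow>
     cring R \<and> (\<forall>x\<in>carrier R. \<forall>n::nat. x [^]\<^bsub>R\<^esub> n = \<zero>\<^bsub>R\<^esub> \<longrightarrow> x = \<zero>\<^bsub>R\<^esub>)"

definition local_ring :: "('a, 'z) ring_scheme \<Rightarrow> 'a set \<Rightarrow> bool" where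
  "local_ring R \<mm> \<longleftrightarrow> cring R \<and> (\<forall>I. maximalideal I R \<longleftrightarrow> I = \<mm>)"

text \<open>The value for the zero ring, which has no primes, is the junk value \<open>Sup {} = 0\<close>.\<close>

definition krull_dim :: "('a, 'z) ring_scheme \<Rightarrow> enat" where
  "krull_dim R = Sup {enat n | n. \<exists>P :: nat \<Rightarrow> 'a set.
     (\<forall>i\<le>n. primeideal (P i) R) \<and> (\<forall>i<n. P i \<subset> P (Suc i))}"

definition jacobson_radical :: "('a, 'z) ring_scheme \<Rightarrow> 'a set" where
  "jacobson_radical R = {x \<in> carrier R. \<forall>M. maximalideal M R \<longrightarrow> x \<in> M}"

definition regular_ideal :: "'a set \<Rightarrow> ('a, 'z) ring_scheme \<Rightarrow> bool" where
  "regular_ideal I R \<longleftrightarrow> ideal I R \<and>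
     (\<exists>r\<in>I. \<forall>x\<in>carrier R. r \<otimes>\<^bsub>R\<^esub> x = \<zero>\<^bsub>R\<^esub> \<longrightarrow> x = \<zero>\<^bsub>R\<^esub>)"

definition minimal_prime :: "'a set \<Rightarrow> ('a, 'z) ring_scheme \<Rightarrow> bool" where
  "minimal_prime P R \<longleftrightarrow>
     primeideal P R \<and> (\<forall>Q. primeideal Q R \<longrightarrow> Q \<subseteq> P \<longrightarrow> Q = P)"

text \<open>
  The power \<open>I\<^sup>n\<close> of an ideal is the \<open>n\<close>-th power in the multiplicative monoid
  \<^const>\<open>ideals_set\<close> of ideals, whose unit is the whole ring.
\<close>

abbreviation ideal_pow :: "('a, 'z) ring_scheme \<Rightarrow> 'a set \<Rightarrow> nat \<Rightarrow> 'a set" where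
  "ideal_pow R I n \<equiv> I [^]\<^bsub>ideals_set R\<^esub> n"

text \<open>\<open>I\<close>-adic completeness: the \<open>I\<close>-adic topology is Hausdorff and Cauchy sequences converge.\<close>

definition adically_complete :: "('a, 'z) ring_scheme \<Rightarrow> 'a set \<Rightarrow> bool" where
  "adically_complete R I \<longleftrightarrow>
     (\<Inter>n. ideal_pow R I n) = {\<zero>\<^bsub>R\<^esub>} \<and>
     (\<forall>x :: nat \<Rightarrow> 'a. range x \<subseteq> carrier R \<longrightarrow>
        (\<forall>n. \<exists>N. \<forall>i\<ge>N. \<forall>j\<ge>N. x i \<ominus>\<^bsub>R\<^esub> x j \<in> ideal_pow R I n) \<longrightarrow>
        (\<exists>l\<in>carrier R. \<forall>n. \<exists>N. \<forall>i\<ge>N. x i \<ominus>\<^bsub>R\<^esub> l \<in> ideal_pow R I n))"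

definition fin_gen_module :: "('r, 'y) ring_scheme \<Rightarrow> ('r, 'm, 'z) module_scheme \<Rightarrow> bool" where
  "fin_gen_module R M \<longleftrightarrow> module R M \<and>
     (\<exists>S. finite S \<and> S \<subseteq> carrier M \<and>
        carrier M = {\<Oplus>\<^bsub>M\<^esub>s\<in>S. c s \<odot>\<^bsub>M\<^esub> s | c. c \<in> S \<rightarrow> carrier R})"

text \<open>
  The ideal \<open>J\<close> of \<open>B\<close> as an \<open>A\<close>-module via \<open>f\<close>. The fields \<open>mult\<close> and \<open>one\<close> are required by the
  record type but play no role in the module structure.
\<close>

definition ideal_as_module ::
  "('a \<Rightarrow> 'b) \<Rightarrow> ('b, 'z) ring_scheme \<Rightarrow> 'b set \<Rightarrow> ('a, 'b) module" where
  "ideal_as_module f B J =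
     \<lparr>carrier = J, monoid.mult = (\<otimes>\<^bsub>B\<^esub>), one = \<one>\<^bsub>B\<^esub>, ring.zero = \<zero>\<^bsub>B\<^esub>, ring.add = (\<oplus>\<^bsub>B\<^esub>),
      smult = (\<lambda>a x. f a \<otimes>\<^bsub>B\<^esub> x)\<rparr>"

section \<open>Homomorphisms, quotients and products of algebras\<close>

definition alg_hom ::
  "('k, 'y) ring_scheme \<Rightarrow> ('k, 'a) module \<Rightarrow> ('k, 'b) module \<Rightarrow> ('a \<Rightarrow> 'b) set" where
  "alg_hom k M N = {\<phi> \<in> ring_hom M N.
     \<forall>c\<in>carrier k. \<forall>x\<in>carrier M. \<phi> (c \<odot>\<^bsub>M\<^esub> x) = c \<odot>\<^bsub>N\<^esub> \<phi> x}"

definition alg_isomorphic ::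
  "('k, 'y) ring_scheme \<Rightarrow> ('k, 'a) module \<Rightarrow> ('k, 'b) module \<Rightarrow> bool" where
  "alg_isomorphic k M N \<longleftrightarrow> (\<exists>\<phi>\<in>alg_hom k M N. bij_betw \<phi> (carrier M) (carrier N))"

text \<open>
  The scalar multiplication on cosets, \<open>c (I + x) = I + c x\<close>, is written as a union over
  representatives, like \<^const>\<open>rcoset_mult\<close>.
\<close>

definition quot_alg :: "('k, 'a) module \<Rightarrow> 'a set \<Rightarrow> ('k, 'a set) module" where
  "quot_alg R I = ring.extend (R Quot I) \<lparr>smult = (\<lambda>c Y. \<Union>x\<in>Y. I +>\<^bsub>R\<^esub> (c \<odot>\<^bsub>R\<^esub> x))\<rparr>"

definition prod_alg :: "('k, 'b) module \<Rightarrow> ('k, 'c) module \<Rightarrow> ('k, 'b \<times> 'c) module" where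
  "prod_alg B C = ring.extend (RDirProd B C)
     \<lparr>smult = (\<lambda>c x. (c \<odot>\<^bsub>B\<^esub> fst x, c \<odot>\<^bsub>C\<^esub> snd x))\<rparr>"

section \<open>Algebroid curves and their branches\<close>

text \<open>
  That the residue field is \<open>k\<close> means that the structure map \<open>k \<rightarrow> R \<rightarrow> R/\<mm>\<close>, \<open>c \<mapsto> \<mm> + c 1\<close>, is bijective.
\<close>

definition algebroid_curve :: "'k ring \<Rightarrow> ('k, 'a) module \<Rightarrow> bool" where
  "algebroid_curve k R \<longleftrightarrow>
     algebraically_closed k \<and> algebra k R \<and> noetherian_ring R \<and> reduced_ring R \<and> krull_dim R = 1 \<and>
     (\<exists>\<mm>. local_ring R \<mm> \<and> adically_complete R \<mm> \<and>
        bij_betw (\<lambda>c. \<mm> +>\<^bsub>R\<^esub> (c \<odot>\<^bsub>R\<^esub> \<one>\<^bsub>R\<^esub>)) (carrier k) (carrier (R Quot \<mm>)))"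

text \<open>
  Distinct minimal primes \<open>P\<close> give distinct quotients \<open>R/P\<close> in this set, since \<open>P\<close> is the zero
  of \<open>R/P\<close>; so isomorphic branches are not identified.
\<close>

definition branches :: "('k, 'a) module \<Rightarrow> ('k, 'a set) module set" where
  "branches R = {quot_alg R P | P. minimal_prime P R}"

section \<open>Bi-amalgamation\<close>

definition image_plus_ideal ::
  "('a \<Rightarrow> 'b) \<Rightarrow> ('k, 'a) module \<Rightarrow> ('k, 'b) module \<Rightarrow> 'b set \<Rightarrow> ('k, 'b) module" where
  "image_plus_ideal f A B J = B\<lparr>carrier := f ` carrier A <+>\<^bsub>B\<^esub> J\<rparr>"

definition bi_amalgamation ::
  "('k, 'a) module \<Rightarrow> ('k, 'b) module \<Rightarrow> ('k, 'c) module \<Rightarrow> ('a \<Rightarrow> 'b) \<Rightarrow> ('a \<Rightarrow> 'c) \<Rightarrow>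
   'b set \<Rightarrow> 'c set \<Rightarrow> ('k, 'b \<times> 'c) module" where
  "bi_amalgamation A B C f g J J' = (prod_alg B C)
     \<lparr>carrier := {(f a \<oplus>\<^bsub>B\<^esub> j, g a \<oplus>\<^bsub>C\<^esub> j') | a j j'. a \<in> carrier A \<and> j \<in> J \<and> j' \<in> J'}\<rparr>"

end

theory Submission
  imports Defs
begin

text \<open>
  Write \<open>R = f(A) + J\<close>, \<open>S = g(A) + J'\<close> and let \<open>D\<close> be the bi-amalgamation. The projections
  \<open>p : D \<rightarrow> R\<close> and \<open>q : D \<rightarrow> S\<close> are surjective and jointly injective, and since
  \<open>f\<^sup>-\<^sup>1(J) = g\<^sup>-\<^sup>1(J')\<close> one has \<open>p (ker q) = J\<close> and \<open>q (ker p) = J'\<close>. As \<open>ker p \<inter> ker q = 0\<close>,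
  every prime of \<open>D\<close> contains \<open>ker p\<close> or \<open>ker q\<close>, so it is pulled back from \<open>R\<close> or from \<open>S\<close>. The
  two maximal ideals pull back to the same ideal because \<open>J\<close> and \<open>J'\<close> are proper. A minimal prime
  contains no regular element, so the minimal primes of \<open>R\<close> do not contain \<open>J\<close>: their preimages are
  minimal in \<open>D\<close> and differ from those coming from \<open>S\<close>, and the quotients agree. In dimension one
  the regular ideals \<open>J\<close> and \<open>J'\<close> contain powers of the maximal ideals, whence \<open>D\<close> is complete.
\<close>

section \<open>Noetherian rings\<close>

text \<open>Zorn's lemma applies because the union of a nonempty chain of ideals in a Noetherian
  ring is itself a member of the chain; the empty chain is bounded by any element of
  \<open>F\<close>.\<close>

lemma (in noetherian_ring) ideal_maximal_element:
  assumes "F \<noteq> {}" "\<And>I. I \<in> F \<Longrightarrow> ideal I R"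
  obtains M where "M \<in> F" "\<And>I. I \<in> F \<Longrightarrow> M \<subseteq> I \<Longrightarrow> I = M"
proof -
  have "\<exists>M\<in>F. \<forall>K\<in>F. M \<subseteq> K \<longrightarrow> K = M"
  proof (rule subset_Zorn)
    fix C assume C: "subset.chain F C"
    show "\<exists>U\<in>F. \<forall>K\<in>C. K \<subseteq> U"
    proof (cases "C = {}")
      case True
      with assms(1) show ?thesis by auto
    next
      case False
      have "subset.chain {I. ideal I R} C"
        using C assms(2) unfolding pred_on.chain_def by blast
      with False have "\<Union>C \<in> C" by (rule ideal_chain_is_trivial)
      moreover from this have "\<Union>C \<in> F" using C unfolding pred_on.chain_def by blast
      ultimately show ?thesis by blast
    qed
  qed
  then obtain M where "M \<in> F" "\<forall>K\<in>F. M \<subseteq> K \<longrightarrow> K = M" ..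
  then show thesis by (intro that[of M]) auto
qed

text \<open>The images under the monotone map \<open>\<phi>\<close> form a chain of ideals, so their
  union is one of them. The members of \<open>C\<close> may be ideals of another ring, which allows
  a chain in a subdirect product to be tested in its two factors.\<close>

lemma (in noetherian_ring) ideal_chain_image:
  assumes "C \<noteq> {}" "\<And>I K. I \<in> C \<Longrightarrow> K \<in> C \<Longrightarrow> I \<subseteq> K \<or> K \<subseteq> I"
    and "\<And>I. I \<in> C \<Longrightarrow> ideal (\<phi> I) R" "\<And>I K. I \<subseteq> K \<Longrightarrow> \<phi> I \<subseteq> \<phi> K"
  obtains I where "I \<in> C" "\<And>K. K \<in> C \<Longrightarrow> \<phi> K \<subseteq> \<phi> I"
proof -
  have "subset.chain {I. ideal I R} (\<phi> ` C)"
    unfolding subset_chain_def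
  proof (intro conjI ballI)
    show "\<phi> ` C \<subseteq> {I. ideal I R}" using assms(3) by blast
    fix A B assume "A \<in> \<phi> ` C" "B \<in> \<phi> ` C"
    then obtain I K where "I \<in> C" "A = \<phi> I" "K \<in> C" "B = \<phi> K" by blast
    then show "A \<subseteq> B \<or> B \<subseteq> A"
      using assms(2)[of I K] assms(4)[of I K] assms(4)[of K I] by blast
  qed
  moreover have "\<phi> ` C \<noteq> {}" using assms(1) by blast
  ultimately have "\<Union>(\<phi> ` C) \<in> \<phi> ` C" by (intro ideal_chain_is_trivial)
  then obtain I where "I \<in> C" "\<Union>(\<phi> ` C) = \<phi> I" by blast
  then show thesis by (intro that[of I]) auto
qed

text \<open>An element maximal among the proper ideals over \<open>I\<close> is maximal among all
  proper ideals.\<close>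

lemma (in noetherian_ring) exists_maximalideal:
  assumes "ideal I R" "I \<noteq> carrier R"
  obtains M where "maximalideal M R" "I \<subseteq> M"
proof -
  let ?A = "{K. ideal K R \<and> I \<subseteq> K \<and> K \<noteq> carrier R}"
  obtain M where M: "M \<in> ?A" "\<And>K. K \<in> ?A \<Longrightarrow> M \<subseteq> K \<Longrightarrow> K = M"
  proof (rule ideal_maximal_element)
    show "?A \<noteq> {}" using assms by blast
  qed auto
  have "maximalideal M R"
  proof (rule maximalidealI)
    fix K assume "ideal K R" "M \<subseteq> K" "K \<subseteq> carrier R"
    then show "K = M \<or> K = carrier R" using M(1) M(2)[of K] by blast
  qed (use M in auto)
  moreover have "I \<subseteq> M" using M(1) by simp
  ultimately show thesis by (rule that)
qed

lemma (in cring) ideal_add_cgenideal: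
  assumes "ideal I R" "a \<in> carrier R"
  shows "ideal (I <+> PIdl a) R" "I \<subseteq> I <+> PIdl a" "a \<in> I <+> PIdl a"
proof -
  interpret I: ideal I R by fact
  have P: "ideal (PIdl a) R" using assms(2) by (rule cgenideal_ideal)
  show "ideal (I <+> PIdl a) R" using assms(1) P by (rule add_ideals)
  show "I \<subseteq> I <+> PIdl a"
    using additive_subgroup.zero_closed[OF ideal.axioms(1)[OF P]] I.Icarr
    by (force simp: set_add_def')
  have "a = \<zero> \<oplus> a" using assms(2) by simp
  then show "a \<in> I <+> PIdl a"
    using cgenideal_self[OF assms(2)] I.zero_closed unfolding set_add_def' by blast
qed

section \<open>Products and powers of ideals\<close>

lemma (in cring) ideal_prod_mono:
  assumes "I \<subseteq> I'" "K \<subseteq> K'"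
  shows "ideal_prod R I K \<subseteq> ideal_prod R I' K'"
proof
  fix x assume "x \<in> ideal_prod R I K"
  then show "x \<in> ideal_prod R I' K'"
    by induction (use assms in \<open>auto intro: ideal_prod.intros\<close>)
qed

lemma (in ring) ideal_prod_subsetI:
  assumes "ideal I R" "\<And>a b. a \<in> A \<Longrightarrow> b \<in> B \<Longrightarrow> a \<otimes> b \<in> I"
  shows "ideal_prod R A B \<subseteq> I"
proof
  fix x assume "x \<in> ideal_prod R A B"
  then show "x \<in> I"
    by induction (use assms in \<open>auto intro: additive_subgroup.a_closed ideal.axioms(1)\<close>)
qed

text \<open>A list allows repeated factors and gives an induction over them; the empty product is
  the unit ideal.\<close>

definition ideal_list_prod :: "('a, 'z) ring_scheme \<Rightarrow> 'a set list \<Rightarrow> 'a set" where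
  "ideal_list_prod R Is = foldr (ideal_prod R) Is (carrier R)"

lemma ideal_list_prod_simps [simp]:
  "ideal_list_prod R [] = carrier R"
  "ideal_list_prod R (I # Is) = ideal_prod R I (ideal_list_prod R Is)"
  by (simp_all add: ideal_list_prod_def)

lemma (in cring) ideal_list_prod_ideal:
  "(\<And>I. I \<in> set Is \<Longrightarrow> ideal I R) \<Longrightarrow> ideal (ideal_list_prod R Is) R"
  by (induction Is) (auto intro: oneideal ideal_prod_is_ideal)

lemma (in cring) ideal_list_prod_append:
  assumes "\<And>I. I \<in> set Is \<Longrightarrow> ideal I R" "\<And>I. I \<in> set Ks \<Longrightarrow> ideal I R"
  shows "ideal_list_prod R (Is @ Ks) = ideal_prod R (ideal_list_prod R Is) (ideal_list_prod R Ks)"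
  using assms
proof (induction Is)
  case Nil
  then show ?case
    by (simp add: ideal_prod_commute[OF oneideal] ideal_prod_one ideal_list_prod_ideal)
next
  case (Cons I Is)
  then show ?case
    by (simp add: ideal_prod_assoc ideal_list_prod_ideal)
qed

text \<open>If neither ideal lay in \<open>P\<close>, elements of \<open>I\<close> and
  \<open>K\<close> outside \<open>P\<close> would have their product in \<open>P\<close>.\<close>

lemma (in cring) primeideal_prod_subset:
  assumes "primeideal P R" "ideal I R" "ideal K R" "ideal_prod R I K \<subseteq> P"
  shows "I \<subseteq> P \<or> K \<subseteq> P"
proof (rule ccontr)
  interpret P: primeideal P R by fact
  assume "\<not> ?thesis"
  then obtain i k where "i \<in> I" "i \<notin> P" "k \<in> K" "k \<notin> P" by blast
  with assms P.I_prime[of i k] show False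
    by (meson ideal.Icarr ideal_prod.prod subsetD)
qed

lemma (in cring) primeideal_list_prod_subset:
  assumes "primeideal P R" "\<And>I. I \<in> set Is \<Longrightarrow> ideal I R" "ideal_list_prod R Is \<subseteq> P"
  shows "\<exists>I\<in>set Is. I \<subseteq> P"
  using assms(2,3)
proof (induction Is)
  case Nil
  interpret P: primeideal P R by fact
  show ?case using Nil P.I_notcarr P.a_subset by auto
next
  case (Cons I Is)
  then show ?case
    using primeideal_prod_subset[OF assms(1), of I "ideal_list_prod R Is"]
    by (auto simp: ideal_list_prod_ideal)
qed

text \<open>This gives powers the append law of list products and lets a product of copies of one
  prime be read as its power. The power multiplies by a new factor on the right, the list product on
  the left, hence \<open>nat_pow_Suc2\<close>.\<close>

lemma (in cring) ideal_pow_eq_list_prod: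
  assumes "ideal I R"
  shows "ideal_pow R I n = ideal_list_prod R (replicate n I)"
proof (induction n)
  case 0
  show ?case by (simp add: ideals_set_def)
next
  case (Suc n)
  interpret IS: comm_monoid "ideals_set R" by (rule ideals_set_is_comm_monoid)
  have I: "I \<in> carrier (ideals_set R)" using assms by (simp add: ideals_set_def)
  have "ideal_pow R I (Suc n) = I \<otimes>\<^bsub>ideals_set R\<^esub> ideal_pow R I n"
    by (rule IS.nat_pow_Suc2[OF I])
  then show ?case using Suc by (simp add: ideals_set_def)
qed

lemma ideal_pow_0: "ideal_pow R I 0 = carrier R"
  by (simp add: ideals_set_def)

lemma ideal_pow_Suc: "ideal_pow R I (Suc n) = ideal_prod R (ideal_pow R I n) I"
  by (simp add: ideals_set_def)

lemma (in cring) ideal_pow_ideal: "ideal I R \<Longrightarrow> ideal (ideal_pow R I n) R"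
  by (auto simp: ideal_pow_eq_list_prod intro: ideal_list_prod_ideal)

lemma (in cring) ideal_pow_add:
  assumes "ideal I R"
  shows "ideal_pow R I (m + n) = ideal_prod R (ideal_pow R I m) (ideal_pow R I n)"
  unfolding ideal_pow_eq_list_prod[OF assms] replicate_add
  by (rule ideal_list_prod_append) (use assms in auto)

text \<open>Noetherian induction: an ideal maximal without this property is proper and not prime, so it
  contains a product of two strictly larger ideals.\<close>

lemma noetherian_prime_product:
  fixes R (structure)
  assumes "noetherian_ring R" "cring R" "ideal I R"
  obtains Ps where "\<And>P. P \<in> set Ps \<Longrightarrow> primeideal P R \<and> I \<subseteq> P" "ideal_list_prod R Ps \<subseteq> I"
proof -
  interpret noetherian_ring R by fact
  interpret cring R by fact
  define good where
    "good I \<longleftrightarrow> (\<exists>Ps. (\<forall>P\<in>set Ps. primeideal P R \<and> I \<subseteq> P) \<and> ideal_list_prod R Ps \<subseteq> I)" for I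
  have "good I"
  proof (rule ccontr)
    assume bad: "\<not> good I"
    obtain M where M: "ideal M R" "\<not> good M"
      and max: "\<And>K. ideal K R \<Longrightarrow> M \<subseteq> K \<Longrightarrow> K \<noteq> M \<Longrightarrow> good K"
    proof -
      have "{K. ideal K R \<and> \<not> good K} \<noteq> {}" using assms(3) bad by blast
      then obtain M where "M \<in> {K. ideal K R \<and> \<not> good K}"
        "\<And>K. K \<in> {K. ideal K R \<and> \<not> good K} \<Longrightarrow> M \<subseteq> K \<Longrightarrow> K = M"
        by (rule ideal_maximal_element) auto
      with that show thesis by blast
    qed
    have "M \<noteq> carrier R"
    proof
      assume "M = carrier R"
      then have "good M" unfolding good_def by (intro exI[of _ "[]"]) auto
      with M show False by simp
    qed
    moreover have "\<not> primeideal M R"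
    proof
      assume P: "primeideal M R"
      then have "ideal_list_prod R [M] \<subseteq> M" using M by (simp add: ideal_prod_one)
      with P have "good M" unfolding good_def by (intro exI[of _ "[M]"]) auto
      with M show False by simp
    qed
    ultimately obtain a b where ab: "a \<in> carrier R" "b \<in> carrier R" "a \<otimes> b \<in> M" "a \<notin> M" "b \<notin> M"
      using primeidealI[OF M(1) cring_axioms] by metis
    \<comment> \<open>Both ideals strictly contain \<open>M\<close>, so maximality of
      \<open>M\<close> makes them good. Their product lies in \<open>M\<close>, so the concatenation
      of their two lists of primes will serve for \<open>M\<close>.\<close>
    have "good (M <+> PIdl a)" "good (M <+> PIdl b)"
      using max ideal_add_cgenideal[OF M(1)] ab by metis+
    then obtain Ps Qs where
      Ps: "\<forall>P\<in>set Ps. primeideal P R \<and> M <+> PIdl a \<subseteq> P" "ideal_list_prod R Ps \<subseteq> M <+> PIdl a"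
      and Qs: "\<forall>P\<in>set Qs. primeideal P R \<and> M <+> PIdl b \<subseteq> P" "ideal_list_prod R Qs \<subseteq> M <+> PIdl b"
      unfolding good_def by (elim exE conjE)
    have "ideal_list_prod R (Ps @ Qs) = ideal_prod R (ideal_list_prod R Ps) (ideal_list_prod R Qs)"
      by (rule ideal_list_prod_append) (simp_all add: Ps(1)[rule_format] Qs(1)[rule_format] primeideal.axioms(1))
    also have "\<dots> \<subseteq> ideal_prod R (M <+> PIdl a) (M <+> PIdl b)"
      by (rule ideal_prod_mono[OF Ps(2) Qs(2)])
    also have "\<dots> \<subseteq> M"
    proof (rule ideal_prod_subsetI[OF M(1)])
      interpret M: ideal M R by fact
      fix x y assume "x \<in> M <+>\<^bsub>R\<^esub> PIdl a" "y \<in> M <+>\<^bsub>R\<^esub> PIdl b"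
      then obtain m u n v where x: "x = m \<oplus> u \<otimes> a" "m \<in> M" "u \<in> carrier R"
        and y: "y = n \<oplus> v \<otimes> b" "n \<in> M" "v \<in> carrier R"
        by (auto simp: set_add_def' cgenideal_def)
      note c = x(3) y(3) ab(1,2) M.Icarr[OF x(2)] M.Icarr[OF y(2)]
      \<comment> \<open>After expansion every term has a factor in \<open>M\<close> or the factor
        \<open>a \<otimes> b\<close>, which lies in \<open>M\<close>.\<close>
      have "x \<otimes> y = m \<otimes> (n \<oplus> v \<otimes> b) \<oplus> ((u \<otimes> a) \<otimes> n \<oplus> (u \<otimes> v) \<otimes> (a \<otimes> b))"
        unfolding x y using c by algebra
      also have "\<dots> \<in> M"
        using c x y ab by (simp add: M.I_l_closed M.I_r_closed)
      finally show "x \<otimes> y \<in> M" .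
    qed
    finally have "ideal_list_prod R (Ps @ Qs) \<subseteq> M" .
    moreover have "\<forall>P\<in>set (Ps @ Qs). primeideal P R \<and> M \<subseteq> P"
      using Ps(1) Qs(1) ideal_add_cgenideal(2)[OF M(1) ab(1)] ideal_add_cgenideal(2)[OF M(1) ab(2)]
      by (metis UnE set_append subset_trans)
    ultimately have "good M" unfolding good_def by blast
    with M show False by simp
  qed
  then obtain Ps where "\<forall>P\<in>set Ps. primeideal P R \<and> I \<subseteq> P" "ideal_list_prod R Ps \<subseteq> I"
    unfolding good_def by blast
  then show thesis by (intro that[of Ps]) auto
qed

section \<open>Minimal primes and regular elements\<close>

text \<open>Some finite product of primes is contained in zero. Each minimal prime contains one of
  the factors and equals it by minimality.\<close>

lemma finite_minimal_primes:
  assumes "noetherian_ring R" "cring R"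
  shows "finite {P. minimal_prime P R}"
proof -
  interpret cring R by fact
  obtain Ps where Ps: "\<And>P. P \<in> set Ps \<Longrightarrow> primeideal P R \<and> {\<zero>\<^bsub>R\<^esub>} \<subseteq> P" "ideal_list_prod R Ps \<subseteq> {\<zero>\<^bsub>R\<^esub>}"
    using noetherian_prime_product[OF assms zeroideal] by blast
  have "P \<in> set Ps" if P: "minimal_prime P R" for P
  proof -
    have prime: "primeideal P R" using P by (simp add: minimal_prime_def)
    have "ideal_list_prod R Ps \<subseteq> P"
      using Ps(2) additive_subgroup.zero_closed[OF ideal.axioms(1)[OF primeideal.axioms(1)[OF prime]]] by auto
    then obtain Q where "Q \<in> set Ps" "Q \<subseteq> P"
      using primeideal_list_prod_subset[OF prime, of Ps] Ps(1) primeideal.axioms(1) by blast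
    with P Ps(1) show ?thesis unfolding minimal_prime_def by blast
  qed
  then show ?thesis by (intro finite_subset[OF _ finite_set[of Ps]]) blast
qed

text \<open>The nonzerodivisor condition inside \<open>regular_ideal\<close>, stated for a single
  element so that it can be moved between rings.\<close>

definition regular_elem :: "('a, 'z) ring_scheme \<Rightarrow> 'a \<Rightarrow> bool" where
  "regular_elem R r \<longleftrightarrow> r \<in> carrier R \<and> (\<forall>x\<in>carrier R. r \<otimes>\<^bsub>R\<^esub> x = \<zero>\<^bsub>R\<^esub> \<longrightarrow> x = \<zero>\<^bsub>R\<^esub>)"

text \<open>A product of primes vanishes; choosing elements of the factors other than \<open>P\<close> outside
  \<open>P\<close> gives \<open>r\<^sup>m s = 0\<close> with \<open>s \<notin> P\<close>.\<close>

lemma minimal_prime_no_regular: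
  assumes "noetherian_ring R" "cring R" "minimal_prime P R" "regular_elem R r"
  shows "r \<notin> P"
proof
  assume r: "r \<in> P"
  interpret cring R by fact
  interpret P: primeideal P R using assms(3) by (simp add: minimal_prime_def)
  have rc: "r \<in> carrier R" using r by (rule P.Icarr)
  obtain Ps where Ps: "\<And>Q. Q \<in> set Ps \<Longrightarrow> primeideal Q R \<and> {\<zero>\<^bsub>R\<^esub>} \<subseteq> Q" "ideal_list_prod R Ps \<subseteq> {\<zero>\<^bsub>R\<^esub>}"
    using noetherian_prime_product[OF assms(1,2) zeroideal] by blast
  \<comment> \<open>The exponent \<open>m\<close> counts the factors equal to \<open>P\<close>;
    \<open>s\<close> is the product of the elements chosen from the other factors.\<close>
  have "\<exists>m s. s \<in> carrier R \<and> s \<notin> P \<and> r [^]\<^bsub>R\<^esub> (m::nat) \<otimes>\<^bsub>R\<^esub> s \<in> ideal_list_prod R Ps"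
    using Ps(1)
  proof (induction Ps)
    case Nil
    have "\<one>\<^bsub>R\<^esub> \<notin> P" using P.one_imp_carrier P.I_notcarr by auto
    then show ?case using rc by (intro exI[of _ 0] exI[of _ "\<one>\<^bsub>R\<^esub>"]) auto
  next
    case (Cons Q Ps)
    then obtain m s where ms: "s \<in> carrier R" "s \<notin> P"
      "r [^]\<^bsub>R\<^esub> (m::nat) \<otimes>\<^bsub>R\<^esub> s \<in> ideal_list_prod R Ps" by auto
    show ?case
    proof (cases "Q = P")
      case True
      have "r [^]\<^bsub>R\<^esub> Suc m \<otimes>\<^bsub>R\<^esub> s = r \<otimes>\<^bsub>R\<^esub> (r [^]\<^bsub>R\<^esub> m \<otimes>\<^bsub>R\<^esub> s)"
        using rc ms(1) by (simp add: m_ac)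
      also have "\<dots> \<in> ideal_list_prod R (Q # Ps)"
        using r ms True by (auto intro: ideal_prod.prod)
      finally show ?thesis using ms by blast
    next
      case False
      have Q: "primeideal Q R" using Cons.prems by simp
      \<comment> \<open>A prime other than the minimal prime \<open>P\<close> cannot be contained in
        \<open>P\<close>.\<close>
      then obtain t where t: "t \<in> Q" "t \<notin> P"
        using assms(3) False unfolding minimal_prime_def by blast
      have tc: "t \<in> carrier R" using t Q primeideal.axioms(1) ideal.Icarr by metis
      have "r [^]\<^bsub>R\<^esub> m \<otimes>\<^bsub>R\<^esub> (t \<otimes>\<^bsub>R\<^esub> s) = t \<otimes>\<^bsub>R\<^esub> (r [^]\<^bsub>R\<^esub> m \<otimes>\<^bsub>R\<^esub> s)"
        using rc ms(1) tc by (simp add: m_lcomm)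
      also have "\<dots> \<in> ideal_list_prod R (Q # Ps)"
        using t ms by (auto intro: ideal_prod.prod)
      finally show ?thesis
        using ms t tc P.I_prime[of t s] by (meson m_closed)
    qed
  qed
  then obtain m s where ms: "s \<in> carrier R" "s \<notin> P" "r [^]\<^bsub>R\<^esub> (m::nat) \<otimes>\<^bsub>R\<^esub> s = \<zero>\<^bsub>R\<^esub>"
    using Ps(2) by blast
  \<comment> \<open>Regularity of \<open>r\<close> cancels the power of \<open>r\<close> one factor
    at a time, which contradicts \<open>s \<notin> P\<close>.\<close>
  have "s = \<zero>\<^bsub>R\<^esub>"
    using ms(3)
  proof (induction m)
    case 0
    then show ?case using ms(1) by simp
  next
    case (Suc m)
    have "r \<otimes>\<^bsub>R\<^esub> (r [^]\<^bsub>R\<^esub> m \<otimes>\<^bsub>R\<^esub> s) = \<zero>\<^bsub>R\<^esub>"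
      using Suc.prems rc ms(1) by (simp add: m_ac)
    moreover have "r [^]\<^bsub>R\<^esub> m \<otimes>\<^bsub>R\<^esub> s \<in> carrier R" using rc ms(1) by simp
    ultimately show ?case using Suc.IH assms(4) unfolding regular_elem_def by blast
  qed
  with ms(2) show False by simp
qed

section \<open>One-dimensional local rings\<close>

lemma local_ring_proper_ideal_subset:
  assumes "noetherian_ring R" "local_ring R \<mm>" "ideal I R" "I \<noteq> carrier R"
  shows "I \<subseteq> \<mm>"
proof -
  obtain M where "maximalideal M R" "I \<subseteq> M"
    using noetherian_ring.exists_maximalideal[OF assms(1,3,4)] .
  with assms(2) show ?thesis by (simp add: local_ring_def)
qed

text \<open>In dimension one a non-maximal prime is minimal, so it contains no regular element.\<close>

lemma local_ring_dim1_prime_eq: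
  assumes "noetherian_ring R" "local_ring R \<mm>" "krull_dim R \<le> 1"
    and "primeideal P R" "r \<in> P" "regular_elem R r"
  shows "P = \<mm>"
proof (rule ccontr)
  assume "P \<noteq> \<mm>"
  interpret cring R using assms(2) by (simp add: local_ring_def)
  have max: "maximalideal \<mm> R" using assms(2) by (simp add: local_ring_def)
  have "P \<subseteq> \<mm>"
    using local_ring_proper_ideal_subset[OF assms(1,2) primeideal.axioms(1)[OF assms(4)]]
      primeideal.I_notcarr[OF assms(4)] by blast
  moreover have "\<not> minimal_prime P R"
    using minimal_prime_no_regular[OF assms(1) cring_axioms] assms(5,6) by blast
  then obtain Q where Q: "primeideal Q R" "Q \<subset> P"
    using assms(4) unfolding minimal_prime_def by blast
  \<comment> \<open>A prime strictly below \<open>P\<close> would give a chain of three primes,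
    indexed here by a list, and hence dimension at least two.\<close>
  ultimately have chain: "\<forall>i\<le>2. primeideal ([Q, P, \<mm>] ! i) R"
    "\<forall>i<2. [Q, P, \<mm>] ! i \<subset> [Q, P, \<mm>] ! Suc i"
    using \<open>P \<noteq> \<mm>\<close> Q assms(4) maximalideal_prime[OF max]
    by (auto simp: numeral_2_eq_2 le_Suc_eq less_Suc_eq)
  then have "enat 2 \<le> krull_dim R"
    unfolding krull_dim_def by (intro Sup_upper) blast
  then have "enat 2 \<le> 1" using assms(3) by (rule order_trans)
  then show False by (simp add: one_enat_def)
qed

text \<open>\<open>I\<close> contains a product of primes lying over it. Each of them contains the
  regular element \<open>r\<close> and so equals \<mm>, which turns the product into a power of
  \<mm>.\<close>

lemma local_ring_dim1_pow_subset:
  assumes "noetherian_ring R" "local_ring R \<mm>" "krull_dim R \<le> 1"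
    and "ideal I R" "r \<in> I" "regular_elem R r"
  obtains e where "ideal_pow R \<mm> e \<subseteq> I"
proof -
  interpret cring R using assms(2) by (simp add: local_ring_def)
  have max: "maximalideal \<mm> R" using assms(2) by (simp add: local_ring_def)
  obtain Ps where Ps: "\<And>P. P \<in> set Ps \<Longrightarrow> primeideal P R \<and> I \<subseteq> P" "ideal_list_prod R Ps \<subseteq> I"
    using noetherian_prime_product[OF assms(1) cring_axioms assms(4)] by blast
  have "\<And>P. P \<in> set Ps \<Longrightarrow> P = \<mm>"
    using Ps(1) local_ring_dim1_prime_eq[OF assms(1-3)] assms(5,6) by blast
  then have "Ps = replicate (length Ps) \<mm>"
    by (metis replicate_length_same)
  then have "ideal_pow R \<mm> (length Ps) \<subseteq> I"
    using Ps(2) ideal_pow_eq_list_prod[OF maximalideal.axioms(1)[OF max]] by metis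
  with that show thesis .
qed

section \<open>Surjective ring homomorphisms\<close>

text \<open>Both projections of the bi-amalgamation are of this kind. The locale collects the
  correspondence between ideals of \<open>S\<close> and ideals of \<open>R\<close> that contain the
  kernel.\<close>

locale surj_ring_hom = ring_hom_cring R S h
  for R (structure) and S (structure) and h +
  assumes surj: "h ` carrier R = carrier S"
begin

definition vimg :: "'c set \<Rightarrow> 'a set" where
  "vimg Q = {x \<in> carrier R. h x \<in> Q}"

definition ker :: "'a set" where
  "ker = {x \<in> carrier R. h x = \<zero>\<^bsub>S\<^esub>}"

lemma ker_ideal: "ideal ker R"
  using ring.kernel_is_ideal unfolding ker_def a_kernel_def' .

lemma vimg_ideal: "ideal Q S \<Longrightarrow> ideal (vimg Q) R"
  unfolding vimg_def by (rule ring.ideal_vimage)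

lemma ker_subset_vimg: "ideal Q S \<Longrightarrow> ker \<subseteq> vimg Q"
  unfolding ker_def vimg_def
  by (auto simp: additive_subgroup.zero_closed ideal.axioms(1))

lemma vimg_carrier: "vimg (carrier S) = carrier R"
  unfolding vimg_def by auto

lemma image_vimg: "Q \<subseteq> carrier S \<Longrightarrow> h ` vimg Q = Q"
  using surj unfolding vimg_def by auto

text \<open>Two elements with the same image differ by an element of the kernel, which already lies
  in \<open>I\<close>.\<close>

lemma vimg_image:
  assumes "ideal I R" "ker \<subseteq> I"
  shows "vimg (h ` I) = I"
proof
  interpret I: ideal I R by fact
  show "I \<subseteq> vimg (h ` I)" unfolding vimg_def using I.Icarr by blast
  show "vimg (h ` I) \<subseteq> I"
  proof
    fix x assume "x \<in> vimg (h ` I)"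
    then obtain y where x: "x \<in> carrier R" and y: "y \<in> I" "h x = h y" by (auto simp: vimg_def)
    have yc: "y \<in> carrier R" using y(1) by (rule I.Icarr)
    have "h (x \<ominus> y) = \<zero>\<^bsub>S\<^esub>"
      using x yc y(2) by (simp add: a_minus_def S.r_neg)
    then have "x \<ominus> y \<in> I" using assms(2) x yc by (auto simp: ker_def)
    then have "(x \<ominus> y) \<oplus> y \<in> I" using y(1) by (rule I.a_closed)
    moreover have "(x \<ominus> y) \<oplus> y = x" using x yc by algebra
    ultimately show "x \<in> I" by simp
  qed
qed

text \<open>Closure under multiplication uses surjectivity: a multiplier from \<open>S\<close> is
  lifted to \<open>R\<close>.\<close>

lemma image_ideal:
  assumes "ideal I R"
  shows "ideal (h ` I) S"
proof (rule idealI)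
  interpret I: ideal I R by fact
  show "ring S" by (rule S.ring_axioms)
  show "subgroup (h ` I) (add_monoid S)"
    using ring.img_is_add_subgroup[OF I.a_subgroup] .
  fix a x assume a: "a \<in> h ` I" and x: "x \<in> carrier S"
  obtain i where i: "i \<in> I" "a = h i" using a by blast
  obtain y where y: "y \<in> carrier R" "x = h y" using x surj by blast
  have "x \<otimes>\<^bsub>S\<^esub> a = h (y \<otimes> i)" "a \<otimes>\<^bsub>S\<^esub> x = h (i \<otimes> y)"
    using i y I.Icarr by simp_all
  moreover have "y \<otimes> i \<in> I" "i \<otimes> y \<in> I"
    using i y I.I_l_closed I.I_r_closed by blast+
  ultimately show "x \<otimes>\<^bsub>S\<^esub> a \<in> h ` I" "a \<otimes>\<^bsub>S\<^esub> x \<in> h ` I"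
    by (metis imageI)+
qed

lemma vimg_prime:
  assumes "primeideal Q S"
  shows "primeideal (vimg Q) R"
proof (rule primeidealI)
  interpret Q: primeideal Q S by fact
  show "ideal (vimg Q) R" by (rule vimg_ideal[OF Q.ideal_axioms])
  show "cring R" by (rule R.is_cring)
  show "carrier R \<noteq> vimg Q"
  proof
    assume "carrier R = vimg Q"
    then have "h \<one> \<in> Q" unfolding vimg_def by blast
    then show False using Q.one_imp_carrier Q.I_notcarr by simp
  qed
  show "\<And>a b. a \<in> carrier R \<Longrightarrow> b \<in> carrier R \<Longrightarrow> a \<otimes> b \<in> vimg Q \<Longrightarrow> a \<in> vimg Q \<or> b \<in> vimg Q"
    unfolding vimg_def using Q.I_prime by auto
qed

text \<open>Since \<open>P\<close> contains the kernel, it is the full preimage of its image, so a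
  product in the image lifts to a product in \<open>P\<close>.\<close>

lemma image_prime:
  assumes "primeideal P R" "ker \<subseteq> P"
  shows "primeideal (h ` P) S"
proof (rule primeidealI)
  interpret P: primeideal P R by fact
  have v: "vimg (h ` P) = P" by (rule vimg_image[OF P.ideal_axioms assms(2)])
  show "ideal (h ` P) S" by (rule image_ideal[OF P.ideal_axioms])
  show "cring S" by (rule S.is_cring)
  show "carrier S \<noteq> h ` P"
    using v P.I_notcarr vimg_carrier by metis
  fix a b assume "a \<in> carrier S" "b \<in> carrier S" and ab: "a \<otimes>\<^bsub>S\<^esub> b \<in> h ` P"
  then obtain x y where xy: "x \<in> carrier R" "a = h x" "y \<in> carrier R" "b = h y"
    using surj by blast
  have "h (x \<otimes> y) \<in> h ` P" using ab xy by simp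
  then have "x \<otimes> y \<in> vimg (h ` P)" using xy unfolding vimg_def by simp
  then have "x \<otimes> y \<in> P" by (simp add: v)
  then show "a \<in> h ` P \<or> b \<in> h ` P" using P.I_prime[OF xy(1,3)] xy by blast
qed

text \<open>An ideal above the preimage contains the kernel, so it is recovered from its image, and
  that image lies above \<open>M\<close>.\<close>

lemma vimg_maximal:
  assumes "maximalideal M S"
  shows "maximalideal (vimg M) R"
proof (rule maximalidealI)
  interpret M: maximalideal M S by fact
  show "ideal (vimg M) R" by (rule vimg_ideal[OF M.ideal_axioms])
  show "carrier R \<noteq> vimg M"
    using image_vimg[OF M.a_subset] surj M.I_notcarr by auto
  fix K assume K: "ideal K R" "vimg M \<subseteq> K" "K \<subseteq> carrier R"
  have v: "vimg (h ` K) = K"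
    using vimg_image[OF K(1)] K(2) ker_subset_vimg[OF M.ideal_axioms] by blast
  have "M \<subseteq> h ` K" using image_vimg[OF M.a_subset] K(2) by blast
  then have "h ` K = M \<or> h ` K = carrier S"
    using M.I_maximal[OF image_ideal[OF K(1)]] ideal.Icarr[OF image_ideal[OF K(1)]] by blast
  then show "K = vimg M \<or> K = carrier R"
  proof
    assume "h ` K = carrier S"
    then have "K = vimg (carrier S)" using v by simp
    then show ?thesis unfolding vimg_def by auto
  qed (use v in auto)
qed

lemma image_maximal:
  assumes "maximalideal M R" "ker \<subseteq> M"
  shows "maximalideal (h ` M) S"
proof (rule maximalidealI)
  interpret M: maximalideal M R by fact
  have v: "vimg (h ` M) = M" by (rule vimg_image[OF M.ideal_axioms assms(2)])
  show "ideal (h ` M) S" by (rule image_ideal[OF M.ideal_axioms])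
  show "carrier S \<noteq> h ` M"
    using v M.I_notcarr vimg_carrier by metis
  fix K assume K: "ideal K S" "h ` M \<subseteq> K" "K \<subseteq> carrier S"
  have "M \<subseteq> vimg K" using K(2) M.a_subset unfolding vimg_def by blast
  then have "vimg K = M \<or> vimg K = carrier R"
    using M.I_maximal[OF vimg_ideal[OF K(1)]] by (auto simp: vimg_def)
  then show "K = h ` M \<or> K = carrier S"
    using image_vimg[OF K(3)] surj by auto
qed

section \<open>Images of products and powers of ideals\<close>

lemma image_ideal_prod:
  assumes "I \<subseteq> carrier R" "K \<subseteq> carrier R"
  shows "h ` ideal_prod R I K = ideal_prod S (h ` I) (h ` K)"
proof
  \<comment> \<open>Membership in the carrier is carried through the induction because additivity of
    \<open>h\<close> is available only there.\<close>
  have *: "x \<in> carrier R \<and> h x \<in> ideal_prod S (h ` I) (h ` K)" if "x \<in> ideal_prod R I K" for x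
    using that
  proof induction
    case (prod i k)
    then have c: "i \<in> carrier R" "k \<in> carrier R" using assms by auto
    have "h i \<otimes>\<^bsub>S\<^esub> h k \<in> ideal_prod S (h ` I) (h ` K)"
      using prod by (intro ideal_prod.prod) auto
    with c show ?case by simp
  next
    case (sum s t)
    then show ?case by (auto intro: ideal_prod.sum)
  qed
  then show "h ` ideal_prod R I K \<subseteq> ideal_prod S (h ` I) (h ` K)" by blast
  show "ideal_prod S (h ` I) (h ` K) \<subseteq> h ` ideal_prod R I K"
  proof
    fix y assume "y \<in> ideal_prod S (h ` I) (h ` K)"
    then show "y \<in> h ` ideal_prod R I K"
    proof induction
      case (prod a b)
      then obtain i k where ik: "i \<in> I" "k \<in> K" "a = h i" "b = h k" by blast
      then have "a \<otimes>\<^bsub>S\<^esub> b = h (i \<otimes> k)" using assms by (simp add: subset_iff)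
      moreover have "i \<otimes> k \<in> ideal_prod R I K" using ik by (intro ideal_prod.prod)
      ultimately show ?case by blast
    next
      case (sum s t)
      then obtain u v where uv: "u \<in> ideal_prod R I K" "s = h u" "v \<in> ideal_prod R I K" "t = h v"
        by blast
      then have "s \<oplus>\<^bsub>S\<^esub> t = h (u \<oplus> v)" using * by simp
      moreover have "u \<oplus> v \<in> ideal_prod R I K" using uv by (intro ideal_prod.sum)
      ultimately show ?case by blast
    qed
  qed
qed

text \<open>For \<open>n = 0\<close> both sides are whole rings and the claim is surjectivity
  itself.\<close>

lemma image_ideal_pow:
  assumes "ideal I R"
  shows "h ` ideal_pow R I n = ideal_pow S (h ` I) n"
proof (induction n)
  case 0
  then show ?case by (simp only: ideal_pow_0 surj)
next
  case (Suc n)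
  have "h ` ideal_prod R (ideal_pow R I n) I = ideal_prod S (h ` ideal_pow R I n) (h ` I)"
    using ideal.Icarr[OF R.ideal_pow_ideal[OF assms]] ideal.Icarr[OF assms]
    by (intro image_ideal_prod) blast+
  then show ?case by (simp only: ideal_pow_Suc Suc)
qed

section \<open>Krull dimension along a surjection\<close>

lemma vimg_strict_mono:
  assumes "ideal P S" "ideal Q S" "P \<subset> Q"
  shows "vimg P \<subset> vimg Q"
proof -
  have "h ` vimg P = P" "h ` vimg Q = Q"
    using ideal.Icarr[OF assms(1)] ideal.Icarr[OF assms(2)] by (blast intro!: image_vimg)+
  then have "vimg P \<noteq> vimg Q" using assms(3) by (metis psubsetE order_refl)
  then show ?thesis using assms(3) unfolding vimg_def by blast
qed

lemma image_strict_mono: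
  assumes "ideal P R" "ideal Q R" "ker \<subseteq> P" "P \<subset> Q"
  shows "h ` P \<subset> h ` Q"
proof -
  have "vimg (h ` P) = P" "vimg (h ` Q) = Q"
    using assms by (blast intro!: vimg_image)+
  then have "h ` P \<noteq> h ` Q" using assms(4) by (metis psubsetE)
  then show ?thesis using assms(4) by blast
qed

text \<open>Preimages turn a strict chain of primes of \<open>S\<close> into one of \<open>R\<close>
  of the same length.\<close>

lemma krull_dim_surj_le: "krull_dim S \<le> krull_dim R"
  unfolding krull_dim_def
proof (rule Sup_subset_mono, clarify)
  fix n and P :: "nat \<Rightarrow> 'c set"
  assume P: "\<forall>i\<le>n. primeideal (P i) S" "\<forall>i<n. P i \<subset> P (Suc i)"
  have "\<forall>i\<le>n. primeideal (vimg (P i)) R"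
    using P(1) vimg_prime by blast
  moreover have "vimg (P i) \<subset> vimg (P (Suc i))" if "i < n" for i
    using that P by (intro vimg_strict_mono primeideal.axioms(1)) auto
  ultimately show "\<exists>m. enat n = enat m \<and> (\<exists>P. (\<forall>i\<le>m. primeideal (P i) R) \<and> (\<forall>i<m. P i \<subset> P (Suc i)))"
    by (intro exI[of _ n] conjI refl exI[of _ "\<lambda>i. vimg (P i)"]) auto
qed

text \<open>A chain whose bottom member contains the kernel descends to \<open>S\<close> without
  collapsing. This bounds the dimension of a ring in which every prime contains the kernel of one of
  two projections.\<close>

lemma prime_chain_le_krull_dim:
  assumes "\<forall>i\<le>n. primeideal (P i) R" "\<forall>i<n. P i \<subset> P (Suc i)" "ker \<subseteq> P 0"
  shows "enat n \<le> krull_dim S"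
proof -
  have ker: "i \<le> n \<Longrightarrow> ker \<subseteq> P i" for i
  proof (induction i)
    case (Suc i)
    then show ?case using assms(2) by (meson Suc_le_lessD Suc_leD psubsetE subset_trans)
  qed (use assms(3) in simp)
  have "\<forall>i\<le>n. primeideal (h ` P i) S"
    using assms(1) ker image_prime by blast
  moreover have "h ` P i \<subset> h ` P (Suc i)" if "i < n" for i
    using that assms(1,2) ker by (intro image_strict_mono primeideal.axioms(1)) auto
  ultimately show ?thesis
    unfolding krull_dim_def
    by (intro Sup_upper CollectI exI[of _ n] conjI refl exI[of _ "\<lambda>i. h ` P i"]) auto
qed

end

section \<open>Subdirect products of two rings\<close>

text \<open>Joint injectivity says that the two kernels meet in zero: \<open>D\<close> embeds in the
  product of \<open>R\<close> and \<open>S\<close> and projects onto each factor.\<close>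

locale subdirect = p: surj_ring_hom D R p + q: surj_ring_hom D S q
  for D (structure) and R and S and p and q +
  assumes joint_inj: "\<lbrakk>x \<in> carrier D; p x = \<zero>\<^bsub>R\<^esub>; q x = \<zero>\<^bsub>S\<^esub>\<rbrakk> \<Longrightarrow> x = \<zero>"
begin

text \<open>By this symmetry a fact proved for \<open>p\<close> is also available for
  \<open>q\<close>.\<close>

lemma swap: "subdirect D S R q p"
  by (intro subdirect.intro subdirect_axioms.intro p.surj_ring_hom_axioms q.surj_ring_hom_axioms)
    (use joint_inj in auto)

lemma joint_eq:
  assumes "x \<in> carrier D" "y \<in> carrier D" "p x = p y" "q x = q y"
  shows "x = y"
proof -
  have "p (x \<ominus> y) = \<zero>\<^bsub>R\<^esub>" "q (x \<ominus> y) = \<zero>\<^bsub>S\<^esub>"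
    using assms by (simp_all add: a_minus_def p.S.r_neg q.S.r_neg)
  then have "x \<ominus> y = \<zero>" using joint_inj assms by simp
  then show ?thesis using assms by simp
qed

text \<open>The product of the two kernels lies in their intersection, which is zero and hence
  contained in \<open>P\<close>.\<close>

lemma ker_prime:
  assumes "primeideal P D"
  shows "p.ker \<subseteq> P \<or> q.ker \<subseteq> P"
proof (rule p.R.primeideal_prod_subset[OF assms p.ker_ideal q.ker_ideal])
  interpret P: primeideal P D by fact
  show "ideal_prod D p.ker q.ker \<subseteq> P"
  proof
    fix x assume "x \<in> ideal_prod D p.ker q.ker"
    then have "x \<in> p.ker" "x \<in> q.ker"
      using p.R.ideal_prod_inter[OF p.ker_ideal q.ker_ideal] by auto
    then have "x = \<zero>" using joint_inj by (simp add: p.ker_def q.ker_def)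
    then show "x \<in> P" by simp
  qed
qed

text \<open>An ideal of \<open>D\<close> is determined within a chain by its image under \<open>p\<close> together with the
  image under \<open>q\<close> of its intersection with \<open>ker p\<close>.\<close>

lemma noetherian:
  assumes "noetherian_ring R" "noetherian_ring S"
  shows "noetherian_ring D"
proof (rule p.R.trivial_ideal_chain_imp_noetherian)
  fix C assume ne: "C \<noteq> {}" and chain: "subset.chain {I. ideal I D} C"
  have id: "\<And>I. I \<in> C \<Longrightarrow> ideal I D" and tot: "\<And>I K. I \<in> C \<Longrightarrow> K \<in> C \<Longrightarrow> I \<subseteq> K \<or> K \<subseteq> I"
    using chain unfolding pred_on.chain_def by blast+
  obtain I1 where I1: "I1 \<in> C" "\<And>K. K \<in> C \<Longrightarrow> p ` K \<subseteq> p ` I1"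
  proof (rule noetherian_ring.ideal_chain_image[OF assms(1) ne tot])
    show "\<And>I. I \<in> C \<Longrightarrow> ideal (p ` I) R" using id by (intro p.image_ideal)
  qed auto
  obtain I2 where I2: "I2 \<in> C" "\<And>K. K \<in> C \<Longrightarrow> q ` (K \<inter> p.ker) \<subseteq> q ` (I2 \<inter> p.ker)"
  proof (rule noetherian_ring.ideal_chain_image[OF assms(2) ne tot])
    show "\<And>I. I \<in> C \<Longrightarrow> ideal (q ` (I \<inter> p.ker)) S"
      using id by (intro q.image_ideal p.R.i_intersect p.ker_ideal)
  qed auto
  obtain I0 where I0: "I0 \<in> C" "I1 \<subseteq> I0" "I2 \<subseteq> I0"
    using tot[OF I1(1) I2(1)] I1(1) I2(1) by blast
  have "I \<subseteq> I0" if I: "I \<in> C" for I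
  proof
    fix x assume x: "x \<in> I"
    have xc: "x \<in> carrier D" using x id[OF I] by (rule ideal.Icarr[rotated])
    have "p x \<in> p ` I1" using I1(2)[OF I] x by blast
    then obtain y where y: "y \<in> I0" "p x = p y" using I0(2) by blast
    have yc: "y \<in> carrier D" using y(1) id[OF I0(1)] by (rule ideal.Icarr[rotated])
    \<comment> \<open>\<open>K\<close> is the larger of \<open>I\<close> and \<open>I0\<close>, so
      it contains the difference of \<open>x\<close> and \<open>y\<close>.\<close>
    obtain K where K: "K \<in> C" "I \<subseteq> K" "I0 \<subseteq> K"
      using tot[OF I I0(1)] I I0(1) by blast
    interpret K: ideal K D using id[OF K(1)] .
    interpret I0: ideal I0 D using id[OF I0(1)] .
    have "x \<ominus> y \<in> K" using x y(1) K unfolding a_minus_def by (intro K.a_closed K.a_inv_closed) auto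
    moreover have "p (x \<ominus> y) = \<zero>\<^bsub>R\<^esub>"
      using xc yc y(2) by (simp add: a_minus_def p.S.r_neg)
    ultimately have "x \<ominus> y \<in> K \<inter> p.ker" using xc yc by (simp add: p.ker_def)
    \<comment> \<open>\<open>I2\<close> has the largest kernel part in the chain, so it supplies
      \<open>z\<close> with the same image under \<open>q\<close> as the difference. Both vanish
      under \<open>p\<close>, hence they agree, and \<open>x\<close> is a sum of elements of
      \<open>I0\<close>.\<close>
    then have "q (x \<ominus> y) \<in> q ` (I2 \<inter> p.ker)" using I2(2)[OF K(1)] by blast
    then obtain z where z: "z \<in> I0" "z \<in> p.ker" "q (x \<ominus> y) = q z" using I0(3) by blast
    have "x \<ominus> y = z"
      using z \<open>p (x \<ominus> y) = \<zero>\<^bsub>R\<^esub>\<close> xc yc by (intro joint_eq) (auto simp: p.ker_def)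
    then have "x = z \<oplus> y" using xc yc I0.Icarr[OF z(1)] 
      by (simp add: a_minus_def p.R.a_assoc p.R.l_neg flip: \<open>x \<ominus> y = z\<close>)
    then show "x \<in> I0" using I0.a_closed[OF z(1) y(1)] by simp
  qed
  then have "\<Union>C = I0" using I0(1) by blast
  then show "\<Union>C \<in> C" using I0(1) by simp
qed

lemma reduced:
  assumes "reduced_ring R" "reduced_ring S"
  shows "reduced_ring D"
  unfolding reduced_ring_def
proof (intro conjI ballI allI impI)
  show "cring D" by (rule p.R.is_cring)
  fix x and n :: nat
  assume x: "x \<in> carrier D" "x [^] n = \<zero>"
  have "p x [^]\<^bsub>R\<^esub> n = \<zero>\<^bsub>R\<^esub>" "q x [^]\<^bsub>S\<^esub> n = \<zero>\<^bsub>S\<^esub>"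
    using p.ring.hom_nat_pow[OF x(1), of n] q.ring.hom_nat_pow[OF x(1), of n] x(2) by auto
  then have "p x = \<zero>\<^bsub>R\<^esub>" "q x = \<zero>\<^bsub>S\<^esub>"
    using assms x(1) unfolding reduced_ring_def by auto
  then show "x = \<zero>" using joint_inj x(1) by simp
qed

text \<open>The bottom prime of a chain in \<open>D\<close> contains one of the kernels, so the
  whole chain descends to \<open>R\<close> or to \<open>S\<close>. The other inequality comes from
  the surjection \<open>p\<close>.\<close>

lemma krull_dim_eq:
  assumes "krull_dim R = d" "krull_dim S = d"
  shows "krull_dim D = d"
proof (rule antisym)
  show "d \<le> krull_dim D" using p.krull_dim_surj_le assms(1) by simp
  have "enat n \<le> d" if "\<forall>i\<le>n. primeideal (P i) D" "\<forall>i<n. P i \<subset> P (Suc i)" for n P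
    using ker_prime[of "P 0"] that p.prime_chain_le_krull_dim[of n P] q.prime_chain_le_krull_dim[of n P] assms
    by auto
  then show "krull_dim D \<le> d"
    unfolding krull_dim_def by (intro Sup_least) auto
qed

end

text \<open>\<open>D\<close> is the fibre product of \<open>R\<close> and \<open>S\<close> over their common quotient
  \<open>D/(ker p + ker q)\<close>.\<close>

locale regular_subdirect = subdirect +
  fixes u v
  assumes noeth: "noetherian_ring R" "noetherian_ring S"
    and proper: "p ` q.ker \<noteq> carrier R" "q ` p.ker \<noteq> carrier S"
    and u: "u \<in> q.ker" "regular_elem R (p u)"
    and v: "v \<in> p.ker" "regular_elem S (q v)"
begin

lemma swap_regular: "regular_subdirect D S R q p v u"
  by (intro regular_subdirect.intro swap regular_subdirect_axioms.intro noeth proper u v)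

section \<open>Minimal primes and the maximal ideal of the glued ring\<close>

text \<open>The regular element \<open>p u\<close> avoids \<open>Q\<close>, so the preimage of
  \<open>Q\<close> omits \<open>u\<close>. A prime below the preimage then cannot contain
  \<open>q.ker\<close>; it contains \<open>p.ker\<close> and descends to a prime below
  \<open>Q\<close>. The second conclusion later separates these primes from those pulled back from
  \<open>S\<close>.\<close>

lemma minimal_prime_vimg:
  assumes "minimal_prime Q R"
  shows "minimal_prime (p.vimg Q) D" "u \<notin> p.vimg Q"
proof -
  have Q: "primeideal Q R" using assms by (simp add: minimal_prime_def)
  have "p u \<notin> Q"
    by (rule minimal_prime_no_regular[OF noeth(1) p.S.is_cring assms u(2)])
  then show uQ: "u \<notin> p.vimg Q" by (simp add: p.vimg_def)
  show "minimal_prime (p.vimg Q) D"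
    unfolding minimal_prime_def
  proof (intro conjI allI impI)
    show "primeideal (p.vimg Q) D" by (rule p.vimg_prime[OF Q])
    fix P assume P: "primeideal P D" "P \<subseteq> p.vimg Q"
    then have ker: "p.ker \<subseteq> P" using ker_prime[OF P(1)] u(1) uQ by blast
    have "p ` P \<subseteq> Q" using P(2) unfolding p.vimg_def by blast
    then have "p ` P = Q"
      using assms p.image_prime[OF P(1) ker] unfolding minimal_prime_def by blast
    then show "P = p.vimg Q" using p.vimg_image[OF primeideal.axioms(1)[OF P(1)] ker] by simp
  qed
qed

lemma minimal_prime_image:
  assumes "minimal_prime P D" "p.ker \<subseteq> P"
  shows "minimal_prime (p ` P) R"
  unfolding minimal_prime_def
proof (intro conjI allI impI)
  have P: "primeideal P D" using assms by (simp add: minimal_prime_def)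
  show "primeideal (p ` P) R" by (rule p.image_prime[OF P assms(2)])
  fix Q assume Q: "primeideal Q R" "Q \<subseteq> p ` P"
  have Qi: "ideal Q R" using Q(1) by (rule primeideal.axioms(1))
  have "p.vimg Q \<subseteq> p.vimg (p ` P)" using Q(2) unfolding p.vimg_def by blast
  then have "p.vimg Q \<subseteq> P" using p.vimg_image[OF primeideal.axioms(1)[OF P] assms(2)] by simp
  then have "p.vimg Q = P" using assms(1) p.vimg_prime[OF Q(1)] unfolding minimal_prime_def by blast
  then show "Q = p ` P" using p.image_vimg[of Q] ideal.Icarr[OF Qi] by blast
qed

text \<open>The image of \<open>q.ker\<close> is a proper ideal of \<open>R\<close> and so lies in
  \<mm>. Thus the preimage of \<mm> contains \<open>q.ker\<close>, and its image under
  \<open>q\<close> is a maximal ideal of \<open>S\<close>, necessarily \<nn>.\<close>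

lemma vimg_maximal_eq:
  assumes "local_ring R \<mm>" "local_ring S \<nn>"
  shows "q.vimg \<nn> = p.vimg \<mm>"
proof -
  have M: "maximalideal \<mm> R" using assms(1) by (simp add: local_ring_def)
  have "p ` q.ker \<subseteq> \<mm>"
    by (rule local_ring_proper_ideal_subset[OF noeth(1) assms(1) p.image_ideal[OF q.ker_ideal] proper(1)])
  then have ker: "q.ker \<subseteq> p.vimg \<mm>" unfolding p.vimg_def q.ker_def by blast
  have V: "maximalideal (p.vimg \<mm>) D" by (rule p.vimg_maximal[OF M])
  have "q ` p.vimg \<mm> = \<nn>"
    using q.image_maximal[OF V ker] assms(2) by (simp add: local_ring_def)
  then show ?thesis
    using q.vimg_image[OF maximalideal.axioms(1)[OF V] ker] by simp
qed

text \<open>A maximal ideal of \<open>D\<close> is prime, so it contains one of the kernels and is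
  pulled back from \<mm> or from \<nn>; these two preimages coincide.\<close>

lemma local_ring_vimg:
  assumes "local_ring R \<mm>" "local_ring S \<nn>"
  shows "local_ring D (p.vimg \<mm>)"
  unfolding local_ring_def
proof (intro conjI allI iffI)
  show "cring D" by (rule p.R.is_cring)
  fix M
  show "maximalideal M D" if "M = p.vimg \<mm>"
    unfolding that using assms(1) by (intro p.vimg_maximal) (simp add: local_ring_def)
  assume M: "maximalideal M D"
  have Mi: "ideal M D" using M by (rule maximalideal.axioms(1))
  have "p.ker \<subseteq> M \<or> q.ker \<subseteq> M"
    by (rule ker_prime[OF p.R.maximalideal_prime[OF M]])
  then show "M = p.vimg \<mm>"
  proof
    assume ker: "p.ker \<subseteq> M"
    then have "p ` M = \<mm>" using p.image_maximal[OF M] assms(1) by (simp add: local_ring_def)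
    then show ?thesis using p.vimg_image[OF Mi ker] by simp
  next
    assume ker: "q.ker \<subseteq> M"
    then have "q ` M = \<nn>" using q.image_maximal[OF M] assms(2) by (simp add: local_ring_def)
    then show ?thesis using q.vimg_image[OF Mi ker] vimg_maximal_eq[OF assms] by simp
  qed
qed

section \<open>Adic completeness of the glued ring\<close>

text \<open>The last \<open>e\<close> factors are absorbed by the image of \<open>q.ker\<close>, so
  \<open>y\<close> lifts to the product of \<open>ideal_pow D I n\<close> and \<open>q.ker\<close>,
  which lies in both. Such a lift adjusts the first coordinate and leaves the second
  unchanged.\<close>

lemma pow_image_ker:
  assumes "ideal I D" "ideal_pow R (p ` I) e \<subseteq> p ` q.ker" "y \<in> ideal_pow R (p ` I) (n + e)"
  obtains w where "w \<in> ideal_pow D I n" "w \<in> q.ker" "p w = y"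
proof -
  have I: "ideal (ideal_pow D I n) D" by (rule p.R.ideal_pow_ideal[OF assms(1)])
  have "ideal_pow R (p ` I) (n + e) = ideal_prod R (ideal_pow R (p ` I) n) (ideal_pow R (p ` I) e)"
    by (rule p.S.ideal_pow_add[OF p.image_ideal[OF assms(1)]])
  also have "\<dots> \<subseteq> ideal_prod R (p ` ideal_pow D I n) (p ` q.ker)"
    unfolding p.image_ideal_pow[OF assms(1)] by (rule p.S.ideal_prod_mono[OF order_refl assms(2)])
  also have "\<dots> = p ` ideal_prod D (ideal_pow D I n) q.ker"
    using ideal.Icarr[OF I] ideal.Icarr[OF q.ker_ideal] by (blast intro!: p.image_ideal_prod[symmetric])
  also have "\<dots> \<subseteq> p ` (ideal_pow D I n \<inter> q.ker)"
    using p.R.ideal_prod_inter[OF I q.ker_ideal] by blast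
  finally have "y \<in> p ` (ideal_pow D I n \<inter> q.ker)" using assms(3) by blast
  with that show thesis by blast
qed

end

lemma adically_complete_limit:
  fixes s :: "nat \<Rightarrow> 'a"
  assumes "adically_complete R I" "\<And>i. s i \<in> carrier R"
    and "\<And>n. \<exists>N. \<forall>i\<ge>N. \<forall>j\<ge>N. s i \<ominus>\<^bsub>R\<^esub> s j \<in> ideal_pow R I n"
  obtains l where "l \<in> carrier R" "\<And>n. \<exists>N. \<forall>i\<ge>N. s i \<ominus>\<^bsub>R\<^esub> l \<in> ideal_pow R I n"
proof -
  have "range s \<subseteq> carrier R" using assms(2) by blast
  with assms(1,3) have "\<exists>l\<in>carrier R. \<forall>n. \<exists>N. \<forall>i\<ge>N. s i \<ominus>\<^bsub>R\<^esub> l \<in> ideal_pow R I n"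
    unfolding adically_complete_def by blast
  then obtain l where "l \<in> carrier R" "\<forall>n. \<exists>N. \<forall>i\<ge>N. s i \<ominus>\<^bsub>R\<^esub> l \<in> ideal_pow R I n" ..
  then show thesis by (intro that[of l]) auto
qed

context regular_subdirect
begin

lemma pow_image_ker':
  assumes "ideal I D" "ideal_pow S (q ` I) e \<subseteq> q ` p.ker" "y \<in> ideal_pow S (q ` I) (n + e)"
  obtains w where "w \<in> ideal_pow D I n" "w \<in> p.ker" "q w = y"
  using regular_subdirect.pow_image_ker[OF swap_regular assms] .

lemma p_minus: "x \<in> carrier D \<Longrightarrow> y \<in> carrier D \<Longrightarrow> p (x \<ominus> y) = p x \<ominus>\<^bsub>R\<^esub> p y"
  by (simp add: a_minus_def)

lemma q_minus: "x \<in> carrier D \<Longrightarrow> y \<in> carrier D \<Longrightarrow> q (x \<ominus> y) = q x \<ominus>\<^bsub>S\<^esub> q y"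
  by (simp add: a_minus_def)

text \<open>Since \<open>p (ker q)\<close> and \<open>q (ker p)\<close> contain powers of the maximal ideals, the adic topology of
  \<open>D\<close> is induced from \<open>R \<times> S\<close>, and \<open>D\<close> is open in \<open>R \<times> S\<close>.\<close>

lemma adically_complete_vimg:
  assumes loc: "local_ring R \<mm>" "local_ring S \<nn>"
    and dim: "krull_dim R \<le> 1" "krull_dim S \<le> 1"
    and comp: "adically_complete R \<mm>" "adically_complete S \<nn>"
  shows "adically_complete D (p.vimg \<mm>)"
proof -
  let ?M = "p.vimg \<mm>"
  have max: "ideal \<mm> R" "ideal \<nn> S" using loc by (auto simp: local_ring_def maximalideal.axioms(1))
  have M: "ideal ?M D" by (rule p.vimg_ideal[OF max(1)])
  have pM: "p ` ?M = \<mm>" using p.image_vimg[of \<mm>] ideal.Icarr[OF max(1)] by blast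
  have qM: "q ` ?M = \<nn>"
    using q.image_vimg[of \<nn>] ideal.Icarr[OF max(2)] vimg_maximal_eq[OF loc] by auto
  have ppow: "p ` ideal_pow D ?M n = ideal_pow R \<mm> n" for n
    using p.image_ideal_pow[OF M] pM by simp
  have qpow: "q ` ideal_pow D ?M n = ideal_pow S \<nn> n" for n
    using q.image_ideal_pow[OF M] qM by simp
  obtain e1 where e1: "ideal_pow R \<mm> e1 \<subseteq> p ` q.ker"
    using local_ring_dim1_pow_subset[OF noeth(1) loc(1) dim(1) p.image_ideal[OF q.ker_ideal] imageI[OF u(1)] u(2)] .
  obtain e2 where e2: "ideal_pow S \<nn> e2 \<subseteq> q ` p.ker"
    using local_ring_dim1_pow_subset[OF noeth(2) loc(2) dim(2) q.image_ideal[OF p.ker_ideal] imageI[OF v(1)] v(2)] .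
  \<comment> \<open>An element with both coordinates deep in the filtrations is the sum of a lift of
    its first coordinate with second coordinate zero and a lift of its second with first coordinate
    zero. The shifts \<open>e1\<close> and \<open>e2\<close> are the price of these lifts.\<close>
  have powI: "x \<in> ideal_pow D ?M n"
    if x: "x \<in> carrier D" "p x \<in> ideal_pow R \<mm> (n + e1)" "q x \<in> ideal_pow S \<nn> (n + e2)" for x n
  proof -
    obtain w where w: "w \<in> ideal_pow D ?M n" "w \<in> q.ker" "p w = p x"
      using pow_image_ker[OF M, of e1 "p x" n] e1 x(2) unfolding pM by blast
    obtain w' where w': "w' \<in> ideal_pow D ?M n" "w' \<in> p.ker" "q w' = q x"
      using pow_image_ker'[OF M, of e2 "q x" n] e2 x(3) unfolding qM by blast
    have "x = w \<oplus> w'"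
      using w w' x(1) by (intro joint_eq) (auto simp: p.ker_def q.ker_def)
    with w(1) w'(1) show ?thesis
      using additive_subgroup.a_closed[OF ideal.axioms(1)[OF p.R.ideal_pow_ideal[OF M]]] by simp
  qed
  show ?thesis
    unfolding adically_complete_def
  proof (intro conjI allI impI)
    show "(\<Inter>n. ideal_pow D ?M n) = {\<zero>}"
    proof
      show "(\<Inter>n. ideal_pow D ?M n) \<subseteq> {\<zero>}"
      proof
        fix x assume x: "x \<in> (\<Inter>n. ideal_pow D ?M n)"
        then have xc: "x \<in> carrier D" using ideal_pow_0[of D ?M] by blast
        have "p x \<in> (\<Inter>n. ideal_pow R \<mm> n)" using x ppow by blast
        then have "p x = \<zero>\<^bsub>R\<^esub>" using comp(1) unfolding adically_complete_def by blast
        have "q x \<in> (\<Inter>n. ideal_pow S \<nn> n)" using x qpow by blast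
        then have "q x = \<zero>\<^bsub>S\<^esub>" using comp(2) unfolding adically_complete_def by blast
        with \<open>p x = \<zero>\<^bsub>R\<^esub>\<close> xc show "x \<in> {\<zero>}" using joint_inj by simp
      qed
      show "{\<zero>} \<subseteq> (\<Inter>n. ideal_pow D ?M n)"
        using additive_subgroup.zero_closed[OF ideal.axioms(1)[OF p.R.ideal_pow_ideal[OF M]]] by simp
    qed
    fix s :: "nat \<Rightarrow> 'a"
    assume "range s \<subseteq> carrier D"
    then have s: "\<And>i. s i \<in> carrier D" by blast
    assume cauchy: "\<forall>n. \<exists>N. \<forall>i\<ge>N. \<forall>j\<ge>N. s i \<ominus> s j \<in> ideal_pow D ?M n"
    \<comment> \<open>The projections map powers of the maximal ideal of \<open>D\<close> onto
      powers of \<mm> and \<nn>, so both coordinate sequences are Cauchy.\<close>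
    have cp: "\<exists>N. \<forall>i\<ge>N. \<forall>j\<ge>N. p (s i) \<ominus>\<^bsub>R\<^esub> p (s j) \<in> ideal_pow R \<mm> n" for n
      using cauchy p_minus[OF s s] ppow by (metis imageI)
    have cq: "\<exists>N. \<forall>i\<ge>N. \<forall>j\<ge>N. q (s i) \<ominus>\<^bsub>S\<^esub> q (s j) \<in> ideal_pow S \<nn> n" for n
      using cauchy q_minus[OF s s] qpow by (metis imageI)
    obtain a where a: "a \<in> carrier R" "\<And>n. \<exists>N. \<forall>i\<ge>N. p (s i) \<ominus>\<^bsub>R\<^esub> a \<in> ideal_pow R \<mm> n"
      using adically_complete_limit[of R \<mm> "\<lambda>i. p (s i)", OF comp(1) p.hom_closed[OF s] cp] by blast
    obtain b where b: "b \<in> carrier S" "\<And>n. \<exists>N. \<forall>i\<ge>N. q (s i) \<ominus>\<^bsub>S\<^esub> b \<in> ideal_pow S \<nn> n"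
      using adically_complete_limit[of S \<nn> "\<lambda>i. q (s i)", OF comp(2) q.hom_closed[OF s] cq] by blast
    obtain N1 where N1: "\<forall>i\<ge>N1. p (s i) \<ominus>\<^bsub>R\<^esub> a \<in> ideal_pow R \<mm> e1" using a(2) by blast
    obtain N2 where N2: "\<forall>i\<ge>N2. q (s i) \<ominus>\<^bsub>S\<^esub> b \<in> ideal_pow S \<nn> e2" using b(2) by blast
    \<comment> \<open>This term is so close to the limits that its errors in the two coordinates lie
      in the images of \<open>q.ker\<close> and \<open>p.ker\<close>.\<close>
    define t where "t = s (max N1 N2)"
    have t: "t \<in> carrier D" unfolding t_def by (rule s)
    have "p t \<ominus>\<^bsub>R\<^esub> a \<in> p ` q.ker" using N1 e1 unfolding t_def by (meson max.cobounded1 subsetD)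
    then obtain w where w: "w \<in> q.ker" "p t \<ominus>\<^bsub>R\<^esub> a = p w" by blast
    have "q t \<ominus>\<^bsub>S\<^esub> b \<in> q ` p.ker" using N2 e2 unfolding t_def by (meson max.cobounded2 subsetD)
    then obtain w' where w': "w' \<in> p.ker" "q t \<ominus>\<^bsub>S\<^esub> b = q w'" by blast
    have wc: "w \<in> carrier D" "q w = \<zero>\<^bsub>S\<^esub>" "w' \<in> carrier D" "p w' = \<zero>\<^bsub>R\<^esub>"
      using w w' by (auto simp: p.ker_def q.ker_def)
    \<comment> \<open>Subtracting \<open>w\<close> corrects only the first coordinate and
      subtracting \<open>w'\<close> only the second. Hence the pair of limits \<open>a\<close> and
      \<open>b\<close> comes from an element of \<open>D\<close>.\<close>
    define l where "l = t \<ominus> (w \<oplus> w')"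
    have l: "l \<in> carrier D" using t wc unfolding l_def by simp
    have "p l = p t \<ominus>\<^bsub>R\<^esub> (p t \<ominus>\<^bsub>R\<^esub> a)"
      unfolding l_def w(2) using t wc by (simp add: p_minus)
    also have "\<dots> = a" using p.hom_closed[OF t] a(1) by algebra
    finally have pl: "p l = a" .
    have "q l = q t \<ominus>\<^bsub>S\<^esub> (q t \<ominus>\<^bsub>S\<^esub> b)"
      unfolding l_def w'(2) using t wc by (simp add: q_minus)
    also have "\<dots> = b" using q.hom_closed[OF t] b(1) by algebra
    finally have ql: "q l = b" .
    show "\<exists>l\<in>carrier D. \<forall>n. \<exists>N. \<forall>i\<ge>N. s i \<ominus> l \<in> ideal_pow D ?M n"
    proof (intro bexI[OF _ l] allI)
      fix n
      obtain K1 where K1: "\<forall>i\<ge>K1. p (s i) \<ominus>\<^bsub>R\<^esub> a \<in> ideal_pow R \<mm> (n + e1)" using a(2) by blast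
      obtain K2 where K2: "\<forall>i\<ge>K2. q (s i) \<ominus>\<^bsub>S\<^esub> b \<in> ideal_pow S \<nn> (n + e2)" using b(2) by blast
      have "s i \<ominus> l \<in> ideal_pow D ?M n" if "i \<ge> max K1 K2" for i
        using K1 K2 that s l pl ql by (intro powI) (auto simp: p_minus q_minus)
      then show "\<exists>N. \<forall>i\<ge>N. s i \<ominus> l \<in> ideal_pow D ?M n" by blast
    qed
  qed
qed

end

section \<open>Quotient algebras\<close>

lemma quot_alg_simps:
  "carrier (quot_alg R I) = a_rcosets\<^bsub>R\<^esub> I"
  "monoid.mult (quot_alg R I) = rcoset_mult R I"
  "monoid.one (quot_alg R I) = I +>\<^bsub>R\<^esub> \<one>\<^bsub>R\<^esub>"
  "ring.zero (quot_alg R I) = I"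
  "ring.add (quot_alg R I) = set_add R"
  "smult (quot_alg R I) = (\<lambda>c Y. \<Union>x\<in>Y. I +>\<^bsub>R\<^esub> (c \<odot>\<^bsub>R\<^esub> x))"
  by (simp_all add: quot_alg_def FactRing_def ring.defs)

text \<open>The zero of a quotient is the ideal itself, so the ideal can be read off.\<close>

lemma inj_quot_alg: "inj (quot_alg R)"
  by (rule injI) (metis quot_alg_simps(4))

lemma carrier_quot_alg: "carrier (quot_alg R I) = (\<lambda>x. I +>\<^bsub>R\<^esub> x) ` carrier R"
  by (auto simp: quot_alg_simps A_RCOSETS_defs a_r_coset_def r_coset_def)

text \<open>Scaling by \<open>c\<close> is multiplication by the ring element \<open>c\<close> times
  one.\<close>

lemma (in algebra) ideal_smult_closed:
  assumes "ideal I M" "c \<in> carrier R" "x \<in> I"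
  shows "c \<odot>\<^bsub>M\<^esub> x \<in> I"
proof -
  have x: "x \<in> carrier M" using ideal.Icarr[OF assms(1,3)] .
  have "(c \<odot>\<^bsub>M\<^esub> \<one>\<^bsub>M\<^esub>) \<otimes>\<^bsub>M\<^esub> x \<in> I"
    using assms by (intro ideal.I_l_closed) auto
  moreover have "(c \<odot>\<^bsub>M\<^esub> \<one>\<^bsub>M\<^esub>) \<otimes>\<^bsub>M\<^esub> x = c \<odot>\<^bsub>M\<^esub> x"
    using assms(2) x by (simp add: smult_assoc2)
  ultimately show ?thesis by simp
qed

text \<open>All representatives contribute the same coset, because their differences, scaled by
  \<open>c\<close>, stay in \<open>I\<close>; the union in \<open>quot_alg\<close> therefore
  collapses.\<close>

lemma quot_alg_smult:
  fixes M :: "('k, 'a) module"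
  assumes "algebra R M" "ideal I M" "c \<in> carrier R" "x \<in> carrier M"
  shows "c \<odot>\<^bsub>quot_alg M I\<^esub> (I +>\<^bsub>M\<^esub> x) = I +>\<^bsub>M\<^esub> (c \<odot>\<^bsub>M\<^esub> x)"
proof -
  interpret algebra R M by fact
  interpret I: ideal I M by fact
  have "I +>\<^bsub>M\<^esub> (c \<odot>\<^bsub>M\<^esub> y) = I +>\<^bsub>M\<^esub> (c \<odot>\<^bsub>M\<^esub> x)" if y: "y \<in> I +>\<^bsub>M\<^esub> x" for y
  proof -
    obtain i where i: "i \<in> I" "y = i \<oplus>\<^bsub>M\<^esub> x" using y by (auto simp: a_r_coset_def')
    have ic: "i \<in> carrier M" using i(1) by (rule I.Icarr)
    have "c \<odot>\<^bsub>M\<^esub> y \<ominus>\<^bsub>M\<^esub> c \<odot>\<^bsub>M\<^esub> x = c \<odot>\<^bsub>M\<^esub> i"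
      using i ic assms(3,4) by (simp add: smult_r_distr a_minus_def M.a_assoc M.r_neg)
    also have "\<dots> \<in> I" by (rule ideal_smult_closed[OF assms(2,3) i(1)])
    finally show ?thesis
      using quotient_eq_iff_same_a_r_cos[OF assms(2)] i ic assms(3,4) by simp
  qed
  moreover have "x \<in> I +>\<^bsub>M\<^esub> x" using I.a_rcos_self[OF assms(4)] .
  ultimately show ?thesis unfolding quot_alg_simps by blast
qed

locale surj_alg_hom = surj_ring_hom R S h
  for k :: "'k ring" and R :: "('k, 'a) module" and S :: "('k, 'b) module" and h +
  assumes algR: "algebra k R" and algS: "algebra k S"
    and hom_smult: "\<lbrakk>c \<in> carrier k; x \<in> carrier R\<rbrakk> \<Longrightarrow> h (c \<odot>\<^bsub>R\<^esub> x) = c \<odot>\<^bsub>S\<^esub> h x"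
begin

lemma smult_closed: "\<lbrakk>c \<in> carrier k; x \<in> carrier R\<rbrakk> \<Longrightarrow> c \<odot>\<^bsub>R\<^esub> x \<in> carrier R"
  using algR by (intro module.smult_closed) (auto dest: algebra.module)

lemma image_coset_vimg:
  assumes "ideal Q S" "x \<in> carrier R"
  shows "h ` (vimg Q +>\<^bsub>R\<^esub> x) = Q +>\<^bsub>S\<^esub> h x"
proof -
  have "Q +>\<^bsub>S\<^esub> h x = {q \<oplus>\<^bsub>S\<^esub> h x | q. q \<in> h ` vimg Q}"
    using image_vimg[of Q] ideal.Icarr[OF assms(1)] by (auto simp: a_r_coset_def')
  also have "\<dots> = h ` (vimg Q +>\<^bsub>R\<^esub> x)"
    using assms(2) by (force simp: a_r_coset_def' vimg_def)
  finally show ?thesis by simp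
qed

text \<open>This is injectivity of the map induced by \<open>h\<close> on quotients. It serves both
  the isomorphism of branches and the comparison of residue fields.\<close>

lemma coset_vimg_eq_iff:
  assumes "ideal Q S" "x \<in> carrier R" "y \<in> carrier R"
  shows "vimg Q +>\<^bsub>R\<^esub> x = vimg Q +>\<^bsub>R\<^esub> y \<longleftrightarrow> Q +>\<^bsub>S\<^esub> h x = Q +>\<^bsub>S\<^esub> h y"
proof -
  have "vimg Q +>\<^bsub>R\<^esub> x = vimg Q +>\<^bsub>R\<^esub> y \<longleftrightarrow> x \<ominus>\<^bsub>R\<^esub> y \<in> vimg Q"
    using R.quotient_eq_iff_same_a_r_cos[OF vimg_ideal[OF assms(1)]] assms by simp
  also have "\<dots> \<longleftrightarrow> h x \<ominus>\<^bsub>S\<^esub> h y \<in> Q"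
    using assms by (simp add: vimg_def a_minus_def)
  also have "\<dots> \<longleftrightarrow> Q +>\<^bsub>S\<^esub> h x = Q +>\<^bsub>S\<^esub> h y"
    using S.quotient_eq_iff_same_a_r_cos[OF assms(1)] assms by simp
  finally show ?thesis .
qed

text \<open>The isomorphism takes the direct image of a coset as a set, which is already a coset of
  \<open>Q\<close>, so no representatives have to be chosen.\<close>

lemma quot_alg_vimg_iso:
  assumes "ideal Q S"
  shows "alg_isomorphic k (quot_alg R (vimg Q)) (quot_alg S Q)"
proof -
  let ?I = "vimg Q"
  have I: "ideal ?I R" by (rule vimg_ideal[OF assms])
  interpret I: ideal ?I R by (rule I)
  interpret Q: ideal Q S by (rule assms)
  note im = image_coset_vimg[OF assms]
  show ?thesis
    unfolding alg_isomorphic_def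
  proof (rule bexI)
    show "bij_betw ((`) h) (carrier (quot_alg R ?I)) (carrier (quot_alg S Q))"
    proof (rule bij_betw_imageI)
      show "inj_on ((`) h) (carrier (quot_alg R ?I))"
      proof (rule inj_onI)
        fix Y Z assume "Y \<in> carrier (quot_alg R ?I)" "Z \<in> carrier (quot_alg R ?I)"
        then obtain y z where "y \<in> carrier R" "Y = ?I +>\<^bsub>R\<^esub> y" "z \<in> carrier R" "Z = ?I +>\<^bsub>R\<^esub> z"
          unfolding carrier_quot_alg by blast
        moreover assume "h ` Y = h ` Z"
        ultimately show "Y = Z" using coset_vimg_eq_iff[OF assms, of y z] im by simp
      qed
      show "(`) h ` carrier (quot_alg R ?I) = carrier (quot_alg S Q)"
        unfolding carrier_quot_alg surj[symmetric] image_image using im by (rule image_cong[OF refl])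
    qed
    show "(`) h \<in> alg_hom k (quot_alg R ?I) (quot_alg S Q)"
      unfolding alg_hom_def
    proof (intro CollectI conjI ballI ring_hom_memI)
      fix Y assume "Y \<in> carrier (quot_alg R ?I)"
      then obtain x where x: "x \<in> carrier R" "Y = ?I +>\<^bsub>R\<^esub> x" by (auto simp: carrier_quot_alg)
      show "h ` Y \<in> carrier (quot_alg S Q)" using x by (auto simp: carrier_quot_alg im)
      fix Z assume "Z \<in> carrier (quot_alg R ?I)"
      then obtain z where z: "z \<in> carrier R" "Z = ?I +>\<^bsub>R\<^esub> z" by (auto simp: carrier_quot_alg)
      show "h ` (Y \<otimes>\<^bsub>quot_alg R ?I\<^esub> Z) = h ` Y \<otimes>\<^bsub>quot_alg S Q\<^esub> h ` Z"
        using x z by (simp add: quot_alg_simps im I.rcoset_mult_add Q.rcoset_mult_add)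
      show "h ` (Y \<oplus>\<^bsub>quot_alg R ?I\<^esub> Z) = h ` Y \<oplus>\<^bsub>quot_alg S Q\<^esub> h ` Z"
        using x z by (simp add: quot_alg_simps im I.a_rcos_sum Q.a_rcos_sum)
    next
      show "h ` \<one>\<^bsub>quot_alg R ?I\<^esub> = \<one>\<^bsub>quot_alg S Q\<^esub>"
        by (simp add: quot_alg_simps im)
    next
      fix c Y assume c: "c \<in> carrier k" and "Y \<in> carrier (quot_alg R ?I)"
      then obtain x where x: "x \<in> carrier R" "Y = ?I +>\<^bsub>R\<^esub> x" by (auto simp: carrier_quot_alg)
      have "c \<odot>\<^bsub>R\<^esub> x \<in> carrier R"
        using c x(1) by (rule smult_closed)
      then show "h ` (c \<odot>\<^bsub>quot_alg R ?I\<^esub> Y) = c \<odot>\<^bsub>quot_alg S Q\<^esub> h ` Y"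
        using c x by (simp add: im hom_smult quot_alg_smult[OF algR I]
            quot_alg_smult[OF algS assms])
    qed
  qed
qed

text \<open>The isomorphism of quotients induced by \<open>h\<close> carries one structure map from
  \<open>k\<close> to the other.\<close>

lemma residue_bij_vimg:
  assumes "ideal Q S"
    and "bij_betw (\<lambda>c. Q +>\<^bsub>S\<^esub> (c \<odot>\<^bsub>S\<^esub> \<one>\<^bsub>S\<^esub>)) (carrier k) (carrier (S Quot Q))"
  shows "bij_betw (\<lambda>c. vimg Q +>\<^bsub>R\<^esub> (c \<odot>\<^bsub>R\<^esub> \<one>\<^bsub>R\<^esub>)) (carrier k) (carrier (R Quot vimg Q))"
proof -
  have Rc: "carrier (R Quot vimg Q) = {vimg Q +>\<^bsub>R\<^esub> x | x. x \<in> carrier R}"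
    and Sc: "carrier (S Quot Q) = {Q +>\<^bsub>S\<^esub> x | x. x \<in> carrier S}"
    by (auto simp: FactRing_simps)
  have c1: "c \<odot>\<^bsub>R\<^esub> \<one>\<^bsub>R\<^esub> \<in> carrier R" if "c \<in> carrier k" for c
    using that by (simp add: smult_closed)
  have eq: "vimg Q +>\<^bsub>R\<^esub> (c \<odot>\<^bsub>R\<^esub> \<one>\<^bsub>R\<^esub>) = vimg Q +>\<^bsub>R\<^esub> x \<longleftrightarrow> Q +>\<^bsub>S\<^esub> (c \<odot>\<^bsub>S\<^esub> \<one>\<^bsub>S\<^esub>) = Q +>\<^bsub>S\<^esub> h x"
    if "c \<in> carrier k" "x \<in> carrier R" for c x
    using coset_vimg_eq_iff[OF assms(1) c1[OF that(1)] that(2)] hom_smult[OF that(1), of "\<one>\<^bsub>R\<^esub>"] by simp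
  show ?thesis
  proof (rule bij_betw_imageI)
    show "inj_on (\<lambda>c. vimg Q +>\<^bsub>R\<^esub> (c \<odot>\<^bsub>R\<^esub> \<one>\<^bsub>R\<^esub>)) (carrier k)"
    proof (rule inj_onI)
      fix c d assume cd: "c \<in> carrier k" "d \<in> carrier k"
        and "vimg Q +>\<^bsub>R\<^esub> (c \<odot>\<^bsub>R\<^esub> \<one>\<^bsub>R\<^esub>) = vimg Q +>\<^bsub>R\<^esub> (d \<odot>\<^bsub>R\<^esub> \<one>\<^bsub>R\<^esub>)"
      then have "Q +>\<^bsub>S\<^esub> (c \<odot>\<^bsub>S\<^esub> \<one>\<^bsub>S\<^esub>) = Q +>\<^bsub>S\<^esub> (d \<odot>\<^bsub>S\<^esub> \<one>\<^bsub>S\<^esub>)"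
        using eq[OF cd(1) c1[OF cd(2)]] hom_smult[OF cd(2), of "\<one>\<^bsub>R\<^esub>"] by simp
      then show "c = d" using assms(2) cd unfolding bij_betw_def inj_on_def by blast
    qed
    show "(\<lambda>c. vimg Q +>\<^bsub>R\<^esub> (c \<odot>\<^bsub>R\<^esub> \<one>\<^bsub>R\<^esub>)) ` carrier k = carrier (R Quot vimg Q)"
    proof
      show "(\<lambda>c. vimg Q +>\<^bsub>R\<^esub> (c \<odot>\<^bsub>R\<^esub> \<one>\<^bsub>R\<^esub>)) ` carrier k \<subseteq> carrier (R Quot vimg Q)"
        using c1 unfolding Rc by blast
      show "carrier (R Quot vimg Q) \<subseteq> (\<lambda>c. vimg Q +>\<^bsub>R\<^esub> (c \<odot>\<^bsub>R\<^esub> \<one>\<^bsub>R\<^esub>)) ` carrier k"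
      proof
        fix Y assume "Y \<in> carrier (R Quot vimg Q)"
        then obtain x where x: "x \<in> carrier R" "Y = vimg Q +>\<^bsub>R\<^esub> x" unfolding Rc by blast
        have "Q +>\<^bsub>S\<^esub> h x \<in> carrier (S Quot Q)" using x(1) unfolding Sc by blast
        then have "Q +>\<^bsub>S\<^esub> h x \<in> (\<lambda>c. Q +>\<^bsub>S\<^esub> (c \<odot>\<^bsub>S\<^esub> \<one>\<^bsub>S\<^esub>)) ` carrier k"
          using assms(2) by (simp add: bij_betw_def)
        then obtain c where c: "c \<in> carrier k" "Q +>\<^bsub>S\<^esub> h x = Q +>\<^bsub>S\<^esub> (c \<odot>\<^bsub>S\<^esub> \<one>\<^bsub>S\<^esub>)" by blast
        then have "vimg Q +>\<^bsub>R\<^esub> (c \<odot>\<^bsub>R\<^esub> \<one>\<^bsub>R\<^esub>) = Y" using eq x by simp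
        then show "Y \<in> (\<lambda>c. vimg Q +>\<^bsub>R\<^esub> (c \<odot>\<^bsub>R\<^esub> \<one>\<^bsub>R\<^esub>)) ` carrier k" using c(1) by blast
      qed
    qed
  qed
qed

end

section \<open>Gluing algebroid curves\<close>

locale glued_curves =
  regular_subdirect D R S p q u v + p: surj_alg_hom k D R p + q: surj_alg_hom k D S q
  for k :: "'k ring" and D :: "('k, 'a) module" and R :: "('k, 'b) module"
    and S :: "('k, 'c) module" and p q u v +
  assumes curves: "algebroid_curve k R" "algebroid_curve k S"
begin

text \<open>The maximal ideal of \<open>D\<close> is the preimage of \<mm>, so its residue field is
  compared with that of \<open>R\<close> alone.\<close>

lemma algebroid_curve: "algebroid_curve k D"
proof -
  obtain \<mm> where m: "local_ring R \<mm>" "adically_complete R \<mm>"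
    "bij_betw (\<lambda>c. \<mm> +>\<^bsub>R\<^esub> (c \<odot>\<^bsub>R\<^esub> \<one>\<^bsub>R\<^esub>)) (carrier k) (carrier (R Quot \<mm>))"
    using curves(1) unfolding algebroid_curve_def by blast
  obtain \<nn> where n: "local_ring S \<nn>" "adically_complete S \<nn>"
    using curves(2) unfolding algebroid_curve_def by blast
  have facts: "algebraically_closed k" "reduced_ring R" "reduced_ring S" "krull_dim R = 1" "krull_dim S = 1"
    using curves unfolding algebroid_curve_def by auto
  have "ideal \<mm> R" using m(1) by (simp add: local_ring_def maximalideal.axioms(1))
  then have "bij_betw (\<lambda>c. p.vimg \<mm> +>\<^bsub>D\<^esub> (c \<odot>\<^bsub>D\<^esub> \<one>\<^bsub>D\<^esub>)) (carrier k) (carrier (D Quot p.vimg \<mm>))"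
    using m(3) by (rule p.residue_bij_vimg)
  moreover have "adically_complete D (p.vimg \<mm>)"
    by (rule adically_complete_vimg[OF m(1) n(1) _ _ m(2) n(2)]) (simp_all add: facts)
  ultimately show ?thesis
    unfolding algebroid_curve_def
    using facts(1) p.algR noetherian[OF noeth] reduced[OF facts(2,3)] krull_dim_eq[OF facts(4,5)]
      local_ring_vimg[OF m(1) n(1)] by blast
qed

text \<open>Both sides are indexed by the disjoint union of the minimal primes of \<open>R\<close>
  and \<open>S\<close>: \<open>\<Psi>\<close> takes quotients of \<open>D\<close> by preimages,
  \<open>\<beta>\<close> takes quotients of \<open>R\<close> and \<open>S\<close>. The map
  \<open>\<Phi>\<close> is \<open>\<beta>\<close> after the inverse of
  \<open>\<Psi>\<close>.\<close>

lemma branches_bij: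
  "\<exists>\<Phi>. bij_betw \<Phi> (branches D) (branches R <+> branches S) \<and>
    (\<forall>B\<in>branches D. case \<Phi> B of Inl T \<Rightarrow> alg_isomorphic k B T | Inr T \<Rightarrow> alg_isomorphic k B T)"
proof -
  let ?minR = "{Q. minimal_prime Q R}" and ?minS = "{Q. minimal_prime Q S}"
  define \<Psi> where "\<Psi> = case_sum (\<lambda>Q. quot_alg D (p.vimg Q)) (\<lambda>Q. quot_alg D (q.vimg Q))"
  define \<beta> where "\<beta> = map_sum (quot_alg R) (quot_alg S)"
  have subR: "ideal Q R" "Q \<subseteq> carrier R" if "minimal_prime Q R" for Q
    using that primeideal.axioms(1)[of Q R] ideal.Icarr[of Q R] by (auto simp: minimal_prime_def)
  have subS: "ideal Q S" "Q \<subseteq> carrier S" if "minimal_prime Q S" for Q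
    using that primeideal.axioms(1)[of Q S] ideal.Icarr[of Q S] by (auto simp: minimal_prime_def)
  have injR: "p.vimg Q = p.vimg Q' \<longleftrightarrow> Q = Q'" if "minimal_prime Q R" "minimal_prime Q' R" for Q Q'
    using p.image_vimg[OF subR(2)[OF that(1)]] p.image_vimg[OF subR(2)[OF that(2)]] by metis
  have injS: "q.vimg Q = q.vimg Q' \<longleftrightarrow> Q = Q'" if "minimal_prime Q S" "minimal_prime Q' S" for Q Q'
    using q.image_vimg[OF subS(2)[OF that(1)]] q.image_vimg[OF subS(2)[OF that(2)]] by metis
  \<comment> \<open>The element \<open>u\<close> separates the two kinds: it lies in
    \<open>q.ker\<close>, hence in every prime pulled back from \<open>S\<close>, and in no minimal
    prime pulled back from \<open>R\<close>.\<close>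
  have disj: "p.vimg Q \<noteq> q.vimg Q'" if "minimal_prime Q R" "minimal_prime Q' S" for Q Q'
    using minimal_prime_vimg(2)[OF that(1)] q.ker_subset_vimg[OF subS(1)[OF that(2)]] u(1) by blast
  have inj: "inj_on \<Psi> (?minR <+> ?minS)"
    by (intro inj_onI) (auto simp: \<Psi>_def inj_eq[OF inj_quot_alg] injR injS disj disj[symmetric])
  have "\<Psi> ` (?minR <+> ?minS) = branches D"
  proof
    show "\<Psi> ` (?minR <+> ?minS) \<subseteq> branches D"
      using minimal_prime_vimg(1) regular_subdirect.minimal_prime_vimg(1)[OF swap_regular]
      by (auto simp: \<Psi>_def branches_def)
    show "branches D \<subseteq> \<Psi> ` (?minR <+> ?minS)"
    proof
      fix B assume "B \<in> branches D"
      then obtain P where P: "minimal_prime P D" "B = quot_alg D P" by (auto simp: branches_def)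
      have prime: "primeideal P D" using P(1) by (simp add: minimal_prime_def)
      note Pi = primeideal.axioms(1)[OF prime]
      from ker_prime[OF prime] show "B \<in> \<Psi> ` (?minR <+> ?minS)"
      proof
        assume ker: "p.ker \<subseteq> P"
        have "B = \<Psi> (Inl (p ` P))" using p.vimg_image[OF Pi ker] P(2) by (simp add: \<Psi>_def)
        then show ?thesis using minimal_prime_image[OF P(1) ker] by blast
      next
        assume ker: "q.ker \<subseteq> P"
        have "B = \<Psi> (Inr (q ` P))" using q.vimg_image[OF Pi ker] P(2) by (simp add: \<Psi>_def)
        then show ?thesis
          using regular_subdirect.minimal_prime_image[OF swap_regular P(1) ker] by blast
      qed
    qed
  qed
  with inj have \<Psi>: "bij_betw \<Psi> (?minR <+> ?minS) (branches D)" by (rule bij_betw_imageI)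
  have "inj \<beta>" unfolding \<beta>_def by (rule sum.inj_map[OF inj_quot_alg inj_quot_alg])
  moreover have "\<beta> ` (?minR <+> ?minS) = branches R <+> branches S"
    by (force simp: \<beta>_def branches_def Plus_def)
  ultimately have \<beta>: "bij_betw \<beta> (?minR <+> ?minS) (branches R <+> branches S)"
    by (intro bij_betw_imageI) (auto intro: inj_on_subset)
  define \<Phi> where "\<Phi> = \<beta> \<circ> inv_into (?minR <+> ?minS) \<Psi>"
  have "bij_betw \<Phi> (branches D) (branches R <+> branches S)"
    unfolding \<Phi>_def by (rule bij_betw_trans[OF bij_betw_inv_into[OF \<Psi>] \<beta>])
  moreover have "case \<Phi> B of Inl T \<Rightarrow> alg_isomorphic k B T | Inr T \<Rightarrow> alg_isomorphic k B T"
    if B: "B \<in> branches D" for B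
  proof -
    obtain z where z: "z \<in> ?minR <+> ?minS" "B = \<Psi> z"
      using B \<Psi> unfolding bij_betw_def by blast
    have "\<Phi> B = \<beta> z" unfolding \<Phi>_def z(2) using inj z(1) by (simp add: inv_into_f_f)
    with z show ?thesis
      using subR(1) subS(1) p.quot_alg_vimg_iso q.quot_alg_vimg_iso
      by (auto simp: \<Psi>_def \<beta>_def)
  qed
  ultimately show ?thesis by blast
qed

text \<open>Since \<open>card\<close> is \<open>0\<close> on infinite sets, finiteness is what turns
  the bijection into a genuine count of branches.\<close>

lemma finite_branches: "finite (branches R)" "finite (branches S)"
proof -
  have "finite {P. minimal_prime P R}" "finite {P. minimal_prime P S}"
    using finite_minimal_primes noeth p.S.is_cring q.S.is_cring by blast+
  then show "finite (branches R)" "finite (branches S)"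
    unfolding branches_def by (simp_all add: setcompr_eq_image)
qed

theorem curve_with_branches:
  "algebroid_curve k D \<and> finite (branches D) \<and>
    card (branches D) = card (branches R) + card (branches S) \<and>
    (\<exists>\<Phi>. bij_betw \<Phi> (branches D) (branches R <+> branches S) \<and>
      (\<forall>B\<in>branches D. case \<Phi> B of Inl T \<Rightarrow> alg_isomorphic k B T | Inr T \<Rightarrow> alg_isomorphic k B T))"
proof -
  obtain \<Phi> where "bij_betw \<Phi> (branches D) (branches R <+> branches S)"
    using branches_bij by blast
  then have "finite (branches D)" "card (branches D) = card (branches R) + card (branches S)"
    using finite_branches by (simp_all add: bij_betw_finite bij_betw_same_card card_Plus)
  then show ?thesis using algebroid_curve branches_bij by blast
qed

end

section \<open>Bi-amalgamations\<close>

lemma subalgebraI: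
  fixes M :: "('k, 'a) module"
  assumes "algebra k M" "subring H M" "\<And>c x. \<lbrakk>c \<in> carrier k; x \<in> H\<rbrakk> \<Longrightarrow> c \<odot>\<^bsub>M\<^esub> x \<in> H"
  shows "algebra k (M\<lparr>carrier := H\<rparr>)"
proof -
  interpret algebra k M by fact
  have H: "x \<in> H \<Longrightarrow> x \<in> carrier M" for x using subringE(1)[OF assms(2)] by blast
  have "cring (M\<lparr>carrier := H\<rparr>)"
    using subcring_iff[OF subringE(1)[OF assms(2)]] subcringI'[OF assms(2)] by simp
  then show ?thesis
    by (intro algebraI)
      (auto simp: assms(3) H R_cring smult_l_distr smult_r_distr smult_assoc1 smult_assoc2)
qed

lemma prod_alg_simps:
  "carrier (prod_alg B C) = carrier B \<times> carrier C"
  "monoid.mult (prod_alg B C) x y = (fst x \<otimes>\<^bsub>B\<^esub> fst y, snd x \<otimes>\<^bsub>C\<^esub> snd y)"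
  "monoid.one (prod_alg B C) = (\<one>\<^bsub>B\<^esub>, \<one>\<^bsub>C\<^esub>)"
  "ring.zero (prod_alg B C) = (\<zero>\<^bsub>B\<^esub>, \<zero>\<^bsub>C\<^esub>)"
  "ring.add (prod_alg B C) x y = (fst x \<oplus>\<^bsub>B\<^esub> fst y, snd x \<oplus>\<^bsub>C\<^esub> snd y)"
  "smult (prod_alg B C) c x = (c \<odot>\<^bsub>B\<^esub> fst x, c \<odot>\<^bsub>C\<^esub> snd x)"
  by (simp_all add: prod_alg_def RDirProd_def DirProd_def ring.defs monoid.defs split: prod.splits)

lemma prod_alg_algebra:
  assumes "algebra k B" "algebra k C"
  shows "algebra k (prod_alg B C)"
proof -
  interpret B: algebra k B by fact
  interpret C: algebra k C by fact
  have "abelian_group (prod_alg B C)"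
  proof (rule abelian_groupI)
    fix x assume "x \<in> carrier (prod_alg B C)"
    then show "\<exists>y\<in>carrier (prod_alg B C). y \<oplus>\<^bsub>prod_alg B C\<^esub> x = \<zero>\<^bsub>prod_alg B C\<^esub>"
      by (intro bexI[of _ "(\<ominus>\<^bsub>B\<^esub> fst x, \<ominus>\<^bsub>C\<^esub> snd x)"]) (auto simp: prod_alg_simps B.M.l_neg C.M.l_neg)
  qed (auto simp: prod_alg_simps B.M.add.m_ac C.M.add.m_ac)
  moreover have "comm_monoid (prod_alg B C)"
    by (rule comm_monoidI) (auto simp: prod_alg_simps B.m_ac C.m_ac)
  ultimately have "cring (prod_alg B C)"
    by (rule cringI) (auto simp: prod_alg_simps B.l_distr C.l_distr)
  then show ?thesis
    by (intro algebraI)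
      (auto simp: prod_alg_simps B.R_cring B.smult_l_distr C.smult_l_distr B.smult_r_distr C.smult_r_distr
        B.smult_assoc1 C.smult_assoc1 B.smult_assoc2 C.smult_assoc2)
qed

lemma carrier_image_plus_ideal:
  "carrier (image_plus_ideal f A B J) = {f a \<oplus>\<^bsub>B\<^esub> j | a j. a \<in> carrier A \<and> j \<in> J}"
  by (auto simp: image_plus_ideal_def set_add_def')

lemma image_plus_ideal_simps:
  "monoid.mult (image_plus_ideal f A B J) = monoid.mult B"
  "monoid.one (image_plus_ideal f A B J) = monoid.one B"
  "ring.zero (image_plus_ideal f A B J) = ring.zero B"
  "ring.add (image_plus_ideal f A B J) = ring.add B"
  "smult (image_plus_ideal f A B J) = smult B"
  by (simp_all add: image_plus_ideal_def)

lemma bi_amalgamation_simps: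
  "monoid.mult (bi_amalgamation A B C f g J J') = monoid.mult (prod_alg B C)"
  "monoid.one (bi_amalgamation A B C f g J J') = monoid.one (prod_alg B C)"
  "ring.zero (bi_amalgamation A B C f g J J') = ring.zero (prod_alg B C)"
  "ring.add (bi_amalgamation A B C f g J J') = ring.add (prod_alg B C)"
  "smult (bi_amalgamation A B C f g J J') = smult (prod_alg B C)"
  by (simp_all add: bi_amalgamation_def)

lemma carrier_bi_amalgamation:
  "carrier (bi_amalgamation A B C f g J J') =
    {(f a \<oplus>\<^bsub>B\<^esub> j, g a \<oplus>\<^bsub>C\<^esub> j') | a j j'. a \<in> carrier A \<and> j \<in> J \<and> j' \<in> J'}"
  by (simp add: bi_amalgamation_def)

section \<open>Computing with representatives of f(A) + J\<close>

text \<open>The data of one factor; it is interpreted for \<open>B\<close>, \<open>f\<close>,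
  \<open>J\<close> and again for \<open>C\<close>, \<open>g\<close>, \<open>J'\<close>.\<close>

locale algebra_hom_ideal =
  A: algebra k A + B: algebra k B + J: ideal J B
  for k :: "'k ring" and A :: "('k, 'a) module" and B :: "('k, 'b) module" and f and J +
  assumes f: "f \<in> alg_hom k A B"
begin

lemma hom: "ring_hom_ring A B f"
  using f by (intro ring_hom_ringI2 A.ring_axioms B.ring_axioms) (simp add: alg_hom_def)

lemma f_closed: "a \<in> carrier A \<Longrightarrow> f a \<in> carrier B"
  and f_minus: "a \<in> carrier A \<Longrightarrow> f (\<ominus>\<^bsub>A\<^esub> a) = \<ominus>\<^bsub>B\<^esub> f a"
proof -
  interpret ring_hom_ring A B f by (rule hom)
  show "a \<in> carrier A \<Longrightarrow> f a \<in> carrier B"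
    "a \<in> carrier A \<Longrightarrow> f (\<ominus>\<^bsub>A\<^esub> a) = \<ominus>\<^bsub>B\<^esub> f a" by simp_all
qed

lemma f_add: "\<lbrakk>a \<in> carrier A; b \<in> carrier A\<rbrakk> \<Longrightarrow> f (a \<oplus>\<^bsub>A\<^esub> b) = f a \<oplus>\<^bsub>B\<^esub> f b"
  and f_mult: "\<lbrakk>a \<in> carrier A; b \<in> carrier A\<rbrakk> \<Longrightarrow> f (a \<otimes>\<^bsub>A\<^esub> b) = f a \<otimes>\<^bsub>B\<^esub> f b"
  using f by (simp_all add: alg_hom_def ring_hom_add ring_hom_mult)

lemma f_one: "f \<one>\<^bsub>A\<^esub> = \<one>\<^bsub>B\<^esub>" and f_zero: "f \<zero>\<^bsub>A\<^esub> = \<zero>\<^bsub>B\<^esub>"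
proof -
  interpret ring_hom_ring A B f by (rule hom)
  show "f \<one>\<^bsub>A\<^esub> = \<one>\<^bsub>B\<^esub>" "f \<zero>\<^bsub>A\<^esub> = \<zero>\<^bsub>B\<^esub>" by simp_all
qed

lemma f_smult: "\<lbrakk>c \<in> carrier k; a \<in> carrier A\<rbrakk> \<Longrightarrow> f (c \<odot>\<^bsub>A\<^esub> a) = c \<odot>\<^bsub>B\<^esub> f a"
  using f by (simp add: alg_hom_def)

text \<open>The elements of \<open>A\<close> on the right-hand sides do not involve \<open>f\<close>, so the same ones serve both
  factors of a bi-amalgamation.\<close>

lemma add_rep:
  assumes "a \<in> carrier A" "i \<in> J" "b \<in> carrier A" "j \<in> J"
  shows "(f a \<oplus>\<^bsub>B\<^esub> i) \<oplus>\<^bsub>B\<^esub> (f b \<oplus>\<^bsub>B\<^esub> j) = f (a \<oplus>\<^bsub>A\<^esub> b) \<oplus>\<^bsub>B\<^esub> (i \<oplus>\<^bsub>B\<^esub> j)"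
  using assms f_closed[of a] f_closed[of b] J.Icarr by (simp add: f_add B.M.add.m_ac)

lemma mult_rep:
  assumes "a \<in> carrier A" "i \<in> J" "b \<in> carrier A" "j \<in> J"
  obtains l where "l \<in> J" "(f a \<oplus>\<^bsub>B\<^esub> i) \<otimes>\<^bsub>B\<^esub> (f b \<oplus>\<^bsub>B\<^esub> j) = f (a \<otimes>\<^bsub>A\<^esub> b) \<oplus>\<^bsub>B\<^esub> l"
proof
  note c = f_closed[OF assms(1)] f_closed[OF assms(3)] J.Icarr[OF assms(2)] J.Icarr[OF assms(4)]
  show "f a \<otimes>\<^bsub>B\<^esub> j \<oplus>\<^bsub>B\<^esub> i \<otimes>\<^bsub>B\<^esub> (f b \<oplus>\<^bsub>B\<^esub> j) \<in> J"
    using assms c by (simp add: J.I_l_closed J.I_r_closed)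
  show "(f a \<oplus>\<^bsub>B\<^esub> i) \<otimes>\<^bsub>B\<^esub> (f b \<oplus>\<^bsub>B\<^esub> j) =
      f (a \<otimes>\<^bsub>A\<^esub> b) \<oplus>\<^bsub>B\<^esub> (f a \<otimes>\<^bsub>B\<^esub> j \<oplus>\<^bsub>B\<^esub> i \<otimes>\<^bsub>B\<^esub> (f b \<oplus>\<^bsub>B\<^esub> j))"
    using assms c by (simp add: f_mult B.l_distr B.r_distr B.M.add.m_ac)
qed

lemma minus_rep:
  assumes "a \<in> carrier A" "i \<in> J"
  shows "\<ominus>\<^bsub>B\<^esub> (f a \<oplus>\<^bsub>B\<^esub> i) = f (\<ominus>\<^bsub>A\<^esub> a) \<oplus>\<^bsub>B\<^esub> (\<ominus>\<^bsub>B\<^esub> i)"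
  using assms f_closed[of a] J.Icarr f_minus[of a] by (simp add: B.M.minus_add)

lemma smult_rep:
  assumes "c \<in> carrier k" "a \<in> carrier A" "i \<in> J"
  shows "c \<odot>\<^bsub>B\<^esub> (f a \<oplus>\<^bsub>B\<^esub> i) = f (c \<odot>\<^bsub>A\<^esub> a) \<oplus>\<^bsub>B\<^esub> c \<odot>\<^bsub>B\<^esub> i" "c \<odot>\<^bsub>B\<^esub> i \<in> J"
  using assms f_closed[of a] J.Icarr B.ideal_smult_closed[OF J.ideal_axioms]
  by (simp_all add: f_smult B.smult_r_distr)

end

section \<open>The bi-amalgamation as an algebra, and its regular elements\<close>

text \<open>In each operation the same element of \<open>A\<close> represents the result in both
  coordinates, so the set of pairs is closed in the product algebra.\<close>

lemma bi_amalgamation_algebra: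
  assumes "algebra_hom_ideal k A B f J" "algebra_hom_ideal k A C g J'"
  shows "algebra k (bi_amalgamation A B C f g J J')"
proof -
  interpret F: algebra_hom_ideal k A B f J by fact
  interpret G: algebra_hom_ideal k A C g J' by fact
  interpret P: algebra k "prod_alg B C"
    by (rule prod_alg_algebra[OF F.B.algebra_axioms G.B.algebra_axioms])
  let ?H = "{(f a \<oplus>\<^bsub>B\<^esub> j, g a \<oplus>\<^bsub>C\<^esub> j') | a j j'. a \<in> carrier A \<and> j \<in> J \<and> j' \<in> J'}"
  have HI: "\<lbrakk>x = (f a \<oplus>\<^bsub>B\<^esub> j, g a \<oplus>\<^bsub>C\<^esub> j'); a \<in> carrier A; j \<in> J; j' \<in> J'\<rbrakk> \<Longrightarrow> x \<in> ?H" for x a j j'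
    by blast
  have sub: "?H \<subseteq> carrier (prod_alg B C)"
    using F.f_closed G.f_closed F.J.Icarr G.J.Icarr by (auto simp: prod_alg_simps)
  have "subring ?H (prod_alg B C)"
  proof (rule P.subringI[OF sub])
    show "\<one>\<^bsub>prod_alg B C\<^esub> \<in> ?H"
      by (rule HI[of _ "\<one>\<^bsub>A\<^esub>" "\<zero>\<^bsub>B\<^esub>" "\<zero>\<^bsub>C\<^esub>"]) (simp_all add: prod_alg_simps F.f_one G.f_one)
  next
    fix x assume x: "x \<in> ?H"
    have xc: "x \<in> carrier (prod_alg B C)" using x sub by blast
    obtain a j j' where a: "x = (f a \<oplus>\<^bsub>B\<^esub> j, g a \<oplus>\<^bsub>C\<^esub> j')" "a \<in> carrier A" "j \<in> J" "j' \<in> J'"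
      using x by blast
    have "\<ominus>\<^bsub>prod_alg B C\<^esub> x = (\<ominus>\<^bsub>B\<^esub> fst x, \<ominus>\<^bsub>C\<^esub> snd x)"
      using xc by (intro P.minus_equality) (auto simp: prod_alg_simps F.B.M.l_neg G.B.M.l_neg)
    then show "\<ominus>\<^bsub>prod_alg B C\<^esub> x \<in> ?H"
      using a by (intro HI[of _ "\<ominus>\<^bsub>A\<^esub> a" "\<ominus>\<^bsub>B\<^esub> j" "\<ominus>\<^bsub>C\<^esub> j'"]) (simp_all add: F.minus_rep G.minus_rep)
    fix y assume "y \<in> ?H"
    then obtain b i i' where b: "y = (f b \<oplus>\<^bsub>B\<^esub> i, g b \<oplus>\<^bsub>C\<^esub> i')" "b \<in> carrier A" "i \<in> J" "i' \<in> J'"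
      by blast
    show "x \<oplus>\<^bsub>prod_alg B C\<^esub> y \<in> ?H"
      using a b by (intro HI[of _ "a \<oplus>\<^bsub>A\<^esub> b" "j \<oplus>\<^bsub>B\<^esub> i" "j' \<oplus>\<^bsub>C\<^esub> i'"])
        (simp_all add: prod_alg_simps F.add_rep G.add_rep)
    obtain l where l: "l \<in> J" "(f a \<oplus>\<^bsub>B\<^esub> j) \<otimes>\<^bsub>B\<^esub> (f b \<oplus>\<^bsub>B\<^esub> i) = f (a \<otimes>\<^bsub>A\<^esub> b) \<oplus>\<^bsub>B\<^esub> l"
      using F.mult_rep[OF a(2,3) b(2,3)] .
    obtain l' where l': "l' \<in> J'" "(g a \<oplus>\<^bsub>C\<^esub> j') \<otimes>\<^bsub>C\<^esub> (g b \<oplus>\<^bsub>C\<^esub> i') = g (a \<otimes>\<^bsub>A\<^esub> b) \<oplus>\<^bsub>C\<^esub> l'"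
      using G.mult_rep[OF a(2,4) b(2,4)] .
    show "x \<otimes>\<^bsub>prod_alg B C\<^esub> y \<in> ?H"
      using a b l l' by (intro HI[of _ "a \<otimes>\<^bsub>A\<^esub> b" l l']) (simp_all add: prod_alg_simps)
  qed
  moreover have "c \<odot>\<^bsub>prod_alg B C\<^esub> x \<in> ?H" if c: "c \<in> carrier k" and x: "x \<in> ?H" for c x
  proof -
    obtain a j j' where a: "x = (f a \<oplus>\<^bsub>B\<^esub> j, g a \<oplus>\<^bsub>C\<^esub> j')" "a \<in> carrier A" "j \<in> J" "j' \<in> J'"
      using x by blast
    then show ?thesis
      using c by (intro HI[of _ "c \<odot>\<^bsub>A\<^esub> a" "c \<odot>\<^bsub>B\<^esub> j" "c \<odot>\<^bsub>C\<^esub> j'"])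
        (simp_all add: prod_alg_simps F.smult_rep G.smult_rep)
  qed
  ultimately show ?thesis
    unfolding bi_amalgamation_def by (intro subalgebraI[OF P.algebra_axioms])
qed

text \<open>\<open>J\<close> lies in the subring because \<open>f\<close> maps zero to zero, and a
  nonzerodivisor of \<open>B\<close> remains one in a subring that contains it.\<close>

lemma regular_elem_image_plus_ideal:
  assumes "algebra_hom_ideal k A B f J" "r \<in> J"
    and "\<And>x. x \<in> carrier B \<Longrightarrow> r \<otimes>\<^bsub>B\<^esub> x = \<zero>\<^bsub>B\<^esub> \<Longrightarrow> x = \<zero>\<^bsub>B\<^esub>"
  shows "regular_elem (image_plus_ideal f A B J) r"
proof -
  interpret F: algebra_hom_ideal k A B f J by fact
  have "r = f \<zero>\<^bsub>A\<^esub> \<oplus>\<^bsub>B\<^esub> r" using F.J.Icarr[OF assms(2)] by (simp add: F.f_zero)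
  then have "r \<in> carrier (image_plus_ideal f A B J)"
    unfolding carrier_image_plus_ideal using assms(2) by blast
  moreover have "x \<in> carrier B" if "x \<in> carrier (image_plus_ideal f A B J)" for x
    using that F.f_closed F.J.Icarr unfolding carrier_image_plus_ideal by auto
  ultimately show ?thesis
    using assms(3) by (simp add: regular_elem_def image_plus_ideal_simps)
qed

theorem theorem4p1:
  fixes k :: "'k ring"
    and A :: "('k, 'a) module" and B :: "('k, 'b) module" and C :: "('k, 'c) module"
    and f :: "'a \<Rightarrow> 'b" and g :: "'a \<Rightarrow> 'c"
    and J :: "'b set" and J' :: "'c set"
  assumes "algebraically_closed k"
    and "algebroid_curve k A"
    and "algebra k B" and "algebra k C"
    and "f \<in> alg_hom k A B" and "g \<in> alg_hom k A C"
    and "regular_ideal J B" and "J \<noteq> carrier B"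
    and "regular_ideal J' C" and "J' \<noteq> carrier C"
    and "algebroid_curve k (image_plus_ideal f A B J)"
    and "algebroid_curve k (image_plus_ideal g A C J')"
    and "fin_gen_module A (ideal_as_module f B J)"
    and "fin_gen_module A (ideal_as_module g C J')"
    and "{a \<in> carrier A. f a \<in> J} = {a \<in> carrier A. g a \<in> J'}"
    and "J \<subseteq> jacobson_radical B" and "J' \<subseteq> jacobson_radical C"
  shows "algebroid_curve k (bi_amalgamation A B C f g J J')
    \<and> finite (branches (bi_amalgamation A B C f g J J'))
    \<and> card (branches (bi_amalgamation A B C f g J J'))
        = card (branches (image_plus_ideal f A B J)) + card (branches (image_plus_ideal g A C J'))
    \<and> (\<exists>\<Phi>. bij_betw \<Phi> (branches (bi_amalgamation A B C f g J J'))
            (Sum_Type.Plus (branches (image_plus_ideal f A B J)) (branches (image_plus_ideal g A C J')))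
          \<and> (\<forall>S \<in> branches (bi_amalgamation A B C f g J J').
               case \<Phi> S of Inl T \<Rightarrow> alg_isomorphic k S T | Inr T \<Rightarrow> alg_isomorphic k S T))"
proof -
  let ?R = "image_plus_ideal f A B J" and ?S = "image_plus_ideal g A C J'"
  let ?D = "bi_amalgamation A B C f g J J'"
  have algA: "algebra k A" and algR: "algebra k ?R" and algS: "algebra k ?S"
    using assms(2,11,12) by (simp_all add: algebroid_curve_def)
  have ideals: "ideal J B" "ideal J' C" using assms(7,9) by (simp_all add: regular_ideal_def)
  have hom_f: "algebra_hom_ideal k A B f J"
    by (intro algebra_hom_ideal.intro algebra_hom_ideal_axioms.intro algA assms ideals)
  have hom_g: "algebra_hom_ideal k A C g J'"
    by (intro algebra_hom_ideal.intro algebra_hom_ideal_axioms.intro algA assms ideals)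
  interpret F: algebra_hom_ideal k A B f J by (rule hom_f)
  interpret G: algebra_hom_ideal k A C g J' by (rule hom_g)
  have algD: "algebra k ?D" by (rule bi_amalgamation_algebra[OF hom_f hom_g])
  have cD: "\<exists>a j j'. x = (f a \<oplus>\<^bsub>B\<^esub> j, g a \<oplus>\<^bsub>C\<^esub> j') \<and> a \<in> carrier A \<and> j \<in> J \<and> j' \<in> J'"
    if "x \<in> carrier ?D" for x
    using that unfolding carrier_bi_amalgamation by blast
  have cDI: "(f a \<oplus>\<^bsub>B\<^esub> j, g a \<oplus>\<^bsub>C\<^esub> j') \<in> carrier ?D" if "a \<in> carrier A" "j \<in> J" "j' \<in> J'" for a j j'
    using that unfolding carrier_bi_amalgamation by blast
  have fst_img: "fst ` carrier ?D = carrier ?R"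
  proof (intro equalityI subsetI)
    fix x assume "x \<in> fst ` carrier ?D"
    then show "x \<in> carrier ?R" using cD unfolding carrier_image_plus_ideal by force
  next
    fix x assume "x \<in> carrier ?R"
    then obtain a j where a: "x = f a \<oplus>\<^bsub>B\<^esub> j" "a \<in> carrier A" "j \<in> J"
      unfolding carrier_image_plus_ideal by blast
    \<comment> \<open>The lift uses zero as the part in \<open>J'\<close>.\<close>
    then show "x \<in> fst ` carrier ?D" using cDI[OF a(2,3) G.J.zero_closed] by (simp add: image_iff) force
  qed
  have snd_img: "snd ` carrier ?D = carrier ?S"
  proof (intro equalityI subsetI)
    fix x assume "x \<in> snd ` carrier ?D"
    then show "x \<in> carrier ?S" using cD unfolding carrier_image_plus_ideal by force
  next
    fix x assume "x \<in> carrier ?S"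
    then obtain a j where a: "x = g a \<oplus>\<^bsub>C\<^esub> j" "a \<in> carrier A" "j \<in> J'"
      unfolding carrier_image_plus_ideal by blast
    then show "x \<in> snd ` carrier ?D" using cDI[OF a(2) F.J.zero_closed a(3)] by (simp add: image_iff) force
  qed
  have hom1: "surj_alg_hom k ?D ?R fst"
  proof (intro surj_alg_hom.intro surj_ring_hom.intro ring_hom_cring.intro ring_hom_cring_axioms.intro
      surj_ring_hom_axioms.intro surj_alg_hom_axioms.intro ring_hom_memI)
    show "x \<in> carrier ?D \<Longrightarrow> fst x \<in> carrier ?R" for x using fst_img by blast
  qed (simp_all add: algD algR algebra.M_cring[OF algD] algebra.M_cring[OF algR] fst_img bi_amalgamation_simps image_plus_ideal_simps
      prod_alg_simps)
  have hom2: "surj_alg_hom k ?D ?S snd"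
  proof (intro surj_alg_hom.intro surj_ring_hom.intro ring_hom_cring.intro ring_hom_cring_axioms.intro
      surj_ring_hom_axioms.intro surj_alg_hom_axioms.intro ring_hom_memI)
    show "x \<in> carrier ?D \<Longrightarrow> snd x \<in> carrier ?S" for x using snd_img by blast
  qed (simp_all add: algD algS algebra.M_cring[OF algD] algebra.M_cring[OF algS] snd_img bi_amalgamation_simps image_plus_ideal_simps
      prod_alg_simps)
  interpret p: surj_alg_hom k ?D ?R fst by (rule hom1)
  interpret q: surj_alg_hom k ?D ?S snd by (rule hom2)
  interpret subdirect ?D ?R ?S fst snd
    by unfold_locales (auto simp: bi_amalgamation_simps image_plus_ideal_simps prod_alg_simps prod_eq_iff)
  \<comment> \<open>If the second coordinate vanishes, then \<open>g a\<close> lies in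
    \<open>J'\<close>. Equality of the preimages of \<open>J\<close> and \<open>J'\<close> puts
    \<open>f a\<close> in \<open>J\<close>, and with it the first coordinate.\<close>
  have kerq: "fst x \<in> J" if "x \<in> q.ker" for x
  proof -
    obtain a j j' where a: "x = (f a \<oplus>\<^bsub>B\<^esub> j, g a \<oplus>\<^bsub>C\<^esub> j')" "a \<in> carrier A" "j \<in> J" "j' \<in> J'"
      using \<open>x \<in> q.ker\<close> cD[of x] unfolding q.ker_def by blast
    have "g a \<oplus>\<^bsub>C\<^esub> j' = \<zero>\<^bsub>C\<^esub>" using \<open>x \<in> q.ker\<close> a by (simp add: q.ker_def image_plus_ideal_simps)
    then have "g a = \<ominus>\<^bsub>C\<^esub> j'"
      using G.B.M.minus_equality[of "g a" j'] a G.f_closed[of a] G.J.Icarr by simp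
    then have "g a \<in> J'" using a(4) by simp
    then have "f a \<in> J" using assms(15) a(2) by blast
    then show ?thesis using a by simp
  qed
  have kerp: "snd x \<in> J'" if "x \<in> p.ker" for x
  proof -
    obtain a j j' where a: "x = (f a \<oplus>\<^bsub>B\<^esub> j, g a \<oplus>\<^bsub>C\<^esub> j')" "a \<in> carrier A" "j \<in> J" "j' \<in> J'"
      using \<open>x \<in> p.ker\<close> cD[of x] unfolding p.ker_def by blast
    have "f a \<oplus>\<^bsub>B\<^esub> j = \<zero>\<^bsub>B\<^esub>" using \<open>x \<in> p.ker\<close> a by (simp add: p.ker_def image_plus_ideal_simps)
    then have "f a = \<ominus>\<^bsub>B\<^esub> j"
      using F.B.M.minus_equality[of "f a" j] a F.f_closed[of a] F.J.Icarr by simp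
    then have "f a \<in> J" using a(3) by simp
    then have "g a \<in> J'" using assms(15) a(2) by blast
    then show ?thesis using a by simp
  qed
  obtain r where r: "r \<in> J" "\<And>x. x \<in> carrier B \<Longrightarrow> r \<otimes>\<^bsub>B\<^esub> x = \<zero>\<^bsub>B\<^esub> \<Longrightarrow> x = \<zero>\<^bsub>B\<^esub>"
    using assms(7) unfolding regular_ideal_def by blast
  obtain s where s: "s \<in> J'" "\<And>x. x \<in> carrier C \<Longrightarrow> s \<otimes>\<^bsub>C\<^esub> x = \<zero>\<^bsub>C\<^esub> \<Longrightarrow> x = \<zero>\<^bsub>C\<^esub>"
    using assms(9) unfolding regular_ideal_def by blast
  \<comment> \<open>Regular elements of \<open>J\<close> and \<open>J'\<close>, padded by zero, are
    the witnesses \<open>u\<close> and \<open>v\<close> of \<open>regular_subdirect\<close>.\<close>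
  have "(r, \<zero>\<^bsub>C\<^esub>) \<in> carrier ?D" "(\<zero>\<^bsub>B\<^esub>, s) \<in> carrier ?D"
    using cDI[of "\<zero>\<^bsub>A\<^esub>" r "\<zero>\<^bsub>C\<^esub>"] cDI[of "\<zero>\<^bsub>A\<^esub>" "\<zero>\<^bsub>B\<^esub>" s] r(1) s(1) F.J.Icarr G.J.Icarr
    by (simp_all add: F.f_zero G.f_zero)
  then have ker: "(r, \<zero>\<^bsub>C\<^esub>) \<in> q.ker" "(\<zero>\<^bsub>B\<^esub>, s) \<in> p.ker"
    by (simp_all add: p.ker_def q.ker_def image_plus_ideal_simps)
  have one: "\<one>\<^bsub>B\<^esub> \<notin> J" "\<one>\<^bsub>C\<^esub> \<notin> J'"
    using F.J.one_imp_carrier G.J.one_imp_carrier assms(8,10) by blast+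
  \<comment> \<open>Equality would put one into \<open>J\<close>, since first coordinates of
    \<open>q.ker\<close> lie in \<open>J\<close>; this contradicts properness of
    \<open>J\<close>.\<close>
  have "fst ` q.ker \<noteq> carrier ?R"
  proof
    assume eq: "fst ` q.ker = carrier ?R"
    have "\<one>\<^bsub>B\<^esub> \<in> carrier ?R" using p.S.one_closed by (simp only: image_plus_ideal_simps)
    then have "\<one>\<^bsub>B\<^esub> \<in> fst ` q.ker" unfolding eq .
    then show False using kerq one(1) by auto
  qed
  moreover have "snd ` p.ker \<noteq> carrier ?S"
  proof
    assume eq: "snd ` p.ker = carrier ?S"
    have "\<one>\<^bsub>C\<^esub> \<in> carrier ?S" using q.S.one_closed by (simp only: image_plus_ideal_simps)
    then have "\<one>\<^bsub>C\<^esub> \<in> snd ` p.ker" unfolding eq .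
    then show False using kerp one(2) by auto
  qed
  moreover have "noetherian_ring ?R" "noetherian_ring ?S"
    using assms(11,12) by (simp_all add: algebroid_curve_def)
  moreover have "regular_elem ?R r" "regular_elem ?S s"
    using regular_elem_image_plus_ideal[OF hom_f r] regular_elem_image_plus_ideal[OF hom_g s] by blast+
  ultimately have "regular_subdirect ?D ?R ?S fst snd (r, \<zero>\<^bsub>C\<^esub>) (\<zero>\<^bsub>B\<^esub>, s)"
    using ker by (intro regular_subdirect.intro subdirect_axioms regular_subdirect_axioms.intro) simp_all
  then have "glued_curves k ?D ?R ?S fst snd (r, \<zero>\<^bsub>C\<^esub>) (\<zero>\<^bsub>B\<^esub>, s)"
    by (intro glued_curves.intro glued_curves_axioms.intro hom1 hom2 assms(11,12))
  then show ?thesis by (rule glued_curves.curve_with_branches)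
qed

end
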